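(* Let $n\ge 1$ and $r>0$. Let $T$ be a Tangle whose links are all arcs of circles of radius $r$ with central angle $2\pi/n$ (i.e., each link is $\frac1n$ of a circle). Then the number of convex links of $T$ exceeds the number of concave links of $T$ by exactly $n$.
   Context: A Tangle is a smooth (continuously turning tangent) simple closed curve in the Euclidean plane that is the union of finitely many arcs, called links, of circles all having the same radius $r$. The region enclosed by the Tangle is the bounded component of the complement of the curve. A link is convex if, near the link, the enclosed region lies on the same side of the link as the center of its circle, and concave otherwise. *)

theory Defs
  imports "HOL-Complex_Analysis.Complex_Analysis"
begin

text \<open>The Euclidean plane is the type \<^typ>\<open>complex\<close>.\<close>

text \<open>
  A simple closed curve (as a point set) with continuously turning tangent: it has a regular
  \<open>C\<^sup>1\<close> parametrization, one-sided at the two ends of \<open>{0..1}\<close>, whose tangent direction also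
  matches at the point where the curve closes up.  The last condition only compares directions,
  so that the speeds at the two ends may differ.
\<close>

definition smooth_simple_closed_curve :: "complex set \<Rightarrow> bool" where
  "smooth_simple_closed_curve T \<longleftrightarrow>
     (\<exists>g g'. simple_path g \<and> pathfinish g = pathstart g \<and> path_image g = T \<and>
        (\<forall>t\<in>{0..1}. (g has_vector_derivative g' t) (at t within {0..1}) \<and> g' t \<noteq> 0) \<and>
        continuous_on {0..1} g' \<and> sgn (g' 0) = sgn (g' 1))"

text \<open>
  A circular arc, up to its radius: it is traversed counterclockwise from the polar angle
  \<open>link_start\<close> (with respect to \<open>link_centre\<close>) through the central angle \<open>link_angle\<close>.
\<close>

datatype link = Link (link_centre: complex) (link_start: real) (link_angle: real)

definition link_path :: "real \<Rightarrow> link \<Rightarrow> real \<Rightarrow> complex" where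
  "link_path r l =
     part_circlepath (link_centre l) r (link_start l) (link_start l + link_angle l)"

definition link_ends :: "real \<Rightarrow> link \<Rightarrow> complex set" where
  "link_ends r l = {pathstart (link_path r l), pathfinish (link_path r l)}"

text \<open>
  \<open>T\<close> is a Tangle and \<open>L\<close> is its set of links.  Distinct links may meet only at common ends.
  In particular the same arc cannot occur in \<open>L\<close> twice with start angles differing by
  a multiple of \<open>2 * pi\<close>, so that \<^term>\<open>card L\<close> really is the number of links.  A central angle
  \<open>2 * pi\<close> (a full circle) is allowed.
\<close>

definition tangle :: "real \<Rightarrow> complex set \<Rightarrow> link set \<Rightarrow> bool" where
  "tangle r T L \<longleftrightarrow>
     smooth_simple_closed_curve T \<and>
     finite L \<and>
     (\<forall>l\<in>L. 0 < link_angle l \<and> link_angle l \<le> 2 * pi) \<and>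
     T = (\<Union>l\<in>L. path_image (link_path r l)) \<and>
     (\<forall>l\<in>L. \<forall>k\<in>L. l \<noteq> k \<longrightarrow>
        path_image (link_path r l) \<inter> path_image (link_path r k) \<subseteq> link_ends r l \<inter> link_ends r k)"

text \<open>
  The enclosed region is \<^term>\<open>inside T\<close>, and the side of a link containing the centre is, near
  the link, the open disc bounded by its circle.  ``Near the link'' means near each point of the
  link other than its ends: at an end, the adjacent link may bend the other way.  The inclusion
  is not vacuous for a Tangle, since every point of a Jordan curve is a limit of points enclosed
  by it.
\<close>

definition convex_link :: "real \<Rightarrow> complex set \<Rightarrow> link \<Rightarrow> bool" where
  "convex_link r T l \<longleftrightarrow>
     (\<forall>p \<in> path_image (link_path r l) - link_ends r l.
        \<exists>e>0. inside T \<inter> ball p e \<subseteq> ball (link_centre l) r)"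

definition concave_link :: "real \<Rightarrow> complex set \<Rightarrow> link \<Rightarrow> bool" where
  "concave_link r T l \<longleftrightarrow> \<not> convex_link r T l"

end

(*
  Hopf's Umlaufsatz for the tangle, without choosing an extremal point.  Parametrize the curve by a
  1-periodic map G and lift the direction of the secants from G s to G t (s <= t <= s + 1) to an angle.
  Exchanging the two ends of a secant changes this angle by a constant M, so the tangent turns by 2 M
  along the whole curve.  A link contributes plus or minus its central angle to the turning, according to the
  direction in which it is traversed.

  Let W = 1 or W = -1 be the winding number of G about the enclosed points.  Replacing a link that is traversed
  counterclockwise by the complementary arc of its circle shows that the winding number jumps from k to
  k + 1 upon entering the disc through the link, and that M = (2 k + 1) pi.  Hence M = W pi, and the
  link is convex iff W = 1; for the opposite direction, iff W = -1.  Summing the turning over all links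
  gives (number of convex links - number of concave links) * (2 pi / n) = 2 pi.
*)

theory Submission
  imports Defs
begin

text \<open>The usual proof of the Umlaufsatz fixes the sign of the half turn at a point where the
  whole curve lies on one side of its tangent. Here any point of any link other than its ends does
  this job, because the secants from it can be compared with chords of the link's own circle, whose
  directions are explicit. Two features of the definition shape the rest. The speeds at the two ends
  of the given parametrization may differ, so the periodic extension can fail to be differentiable
  there; only the convergence of chord directions to a unit tangent is used. And the links form an
  unordered set, each described counterclockwise and without reference to the curve's parameter. A
  parameter along the curve has to be recovered for each link; where it decreases, the reversed
  curve is used. For n = 1 the links are full circles, whose two ends coincide, so injectivity of
  this parameter takes an argument of its own.\<close>

section \<open>Continuous angles of unit vectors\<close>

lemma cis_lift_constant:
  fixes f :: "'a::topological_space \<Rightarrow> real"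
  assumes "connected S" "continuous_on S f" "\<And>x. x \<in> S \<Longrightarrow> cis (f x) = c" "x \<in> S" "y \<in> S"
  shows "f x = f y"
proof -
  have "f constant_on S"
  proof (rule continuous_discrete_range_constant[OF assms(1,2)])
    fix x assume x: "x \<in> S"
    \<comment> \<open>Angles with the same \<open>cis\<close> differ by a multiple of 2 pi, so
      distinct values of \<open>f\<close> are at least this far apart and the range is
      discrete.\<close>
    have "2 * pi \<le> norm (f y - f x)" if "y \<in> S" "f y \<noteq> f x" for y
    proof -
      have "cis (f y - f x) = 1"
        using assms(3)[OF x, symmetric] assms(3)[OF that(1)] by (simp add: cis_divide[symmetric])
      then have "cos (f y - f x) = 1"
        by (metis cis.simps(1) one_complex.simps(1))
      then obtain n :: int where n: "f y - f x = of_int n * 2 * pi"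
        using cos_one_2pi_int by blast
      with that have "n \<noteq> 0" by auto
      then have "\<bar>real_of_int n\<bar> \<ge> 1" by linarith
      then show ?thesis unfolding n by (simp add: abs_mult)
    qed
    then show "\<exists>e>0. \<forall>y. y \<in> S \<and> f y \<noteq> f x \<longrightarrow> e \<le> norm (f y - f x)"
      by (intro exI[of _ "2 * pi"]) auto
  qed
  then show ?thesis using assms(4,5) unfolding constant_on_def by metis
qed

text \<open>Both functions are angles of one direction up to the fixed rotation \<open>c\<close>, so
  \<open>f - g\<close> is constant. Changes of angle are computed below in this way, by comparing
  two lifts.\<close>

lemma cis_lift_diff_eq:
  fixes f g :: "'a::topological_space \<Rightarrow> real"
  assumes "connected S" "continuous_on S f" "continuous_on S g"
    and "\<And>x. x \<in> S \<Longrightarrow> cis (f x) = c * cis (g x)" "x \<in> S" "y \<in> S"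
  shows "f x - f y = g x - g y"
proof -
  have "f x - g x = f y - g y"
  proof (rule cis_lift_constant[OF assms(1), where c = c])
    show "continuous_on S (\<lambda>x. f x - g x)" by (intro continuous_intros assms)
    fix z assume "z \<in> S"
    then show "cis (f z - g z) = c" using assms(4)[of z] by (simp add: cis_divide[symmetric])
  qed (use assms in auto)
  then show ?thesis by simp
qed

lemma cis_lift_exists:
  fixes h :: "'a::real_normed_vector \<Rightarrow> complex"
  assumes "convex S" "continuous_on S h" "\<And>x. x \<in> S \<Longrightarrow> norm (h x) = 1"
  obtains f where "continuous_on S f" "\<And>x. x \<in> S \<Longrightarrow> h x = cis (f x)"
proof -
  have "\<And>x. x \<in> S \<Longrightarrow> h x \<noteq> 0" using assms(3) by fastforce
  then obtain q where q: "continuous_on S q" "\<And>x. x \<in> S \<Longrightarrow> h x = exp (q x)"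
    using continuous_logarithm_on_contractible[OF assms(2) convex_imp_contractible[OF assms(1)]] by blast
  show ?thesis
  proof
    show "continuous_on S (\<lambda>x. Im (q x))" by (intro continuous_intros q)
    fix x assume "x \<in> S"
    then have "Re (q x) = 0" "h x = exp (q x)" using q assms(3)[of x] by auto
    then show "h x = cis (Im (q x))" by (simp add: exp_eq_polar)
  qed
qed

lemma ge_one_if_Ints: "x \<in> \<int> \<Longrightarrow> 0 < x \<Longrightarrow> 1 \<le> (x::real)"
  by (auto elim!: Ints_cases)

section \<open>Closed curves with tangents and the directions of their secants\<close>

text \<open>\<open>chord_tangent\<close> concerns all short chords near \<open>t\<close>, also those
  with \<open>t\<close> strictly between their parameters. It replaces a derivative, which can fail
  to exist where the curve closes up with different speeds, and it is what extends the secant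
  direction continuously to the diagonal.\<close>

locale tangent_loop =
  fixes G :: "real \<Rightarrow> complex" and \<tau> :: "real \<Rightarrow> complex"
  assumes continuous_G: "continuous_on UNIV G"
    and G_eq_iff: "G s = G t \<longleftrightarrow> t - s \<in> \<int>"
    and norm_tangent: "norm (\<tau> t) = 1"
    and tangent_add_1: "\<tau> (t + 1) = \<tau> t"
    and chord_tangent: "e > 0 \<Longrightarrow> \<exists>d>0. \<forall>s u. t - d < s \<and> s < u \<and> u < t + d \<longrightarrow>
       norm (sgn (G u - G s) - \<tau> t) < e"
begin

lemma G_add_1 [simp]: "G (t + 1) = G t"
  by (simp add: G_eq_iff)

lemma continuous_G_comp [continuous_intros]: "continuous_on S f \<Longrightarrow> continuous_on S (\<lambda>x. G (f x))"
  using continuous_on_compose2[OF continuous_G, of S f] by auto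

lemma G_ne: "s < t \<Longrightarrow> t < s + 1 \<Longrightarrow> G s \<noteq> G t"
  using ge_one_if_Ints[of "t - s"] by (auto simp: G_eq_iff)

text \<open>Reversal exchanges the ends of each chord and so the sign of the tangent. It serves to
  treat a link traversed clockwise as one traversed counterclockwise.\<close>

lemma reverse: "tangent_loop (\<lambda>t. G (- t)) (\<lambda>t. - \<tau> (- t))"
proof
  show "continuous_on UNIV (\<lambda>t. G (- t))" by (intro continuous_intros)
  show "G (- s) = G (- t) \<longleftrightarrow> t - s \<in> \<int>" for s t
    using G_eq_iff[of "-s" "-t"] minus_in_Ints_iff[of "t - s"] by simp
  show "cmod (- \<tau> (- t)) = 1" for t by (simp add: norm_tangent)
  show "- \<tau> (- (t + 1)) = - \<tau> (- t)" for t using tangent_add_1[of "-t - 1"] by simp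
  fix e t :: real assume "e > 0"
  then obtain d where d: "d > 0" "\<And>s u. - t - d < s \<and> s < u \<and> u < - t + d \<Longrightarrow>
       norm (sgn (G u - G s) - \<tau> (-t)) < e" using chord_tangent[of e "-t"] by auto
  have "norm (sgn (G (- u) - G (- s)) - - \<tau> (- t)) < e" if "t - d < s \<and> s < u \<and> u < t + d" for s u
  proof -
    have "sgn (G (- u) - G (- s)) - - \<tau> (- t) = - (sgn (G (-s) - G (-u)) - \<tau> (-t))"
      using sgn_minus[of "G (-s) - G (-u)"] by simp
    moreover have "norm (sgn (G (- s) - G (- u)) - \<tau> (- t)) < e"
      using that by (intro d(2)) auto
    ultimately show ?thesis by (simp only: norm_minus_cancel)
  qed
  then show "\<exists>d>0. \<forall>s u. t - d < s \<and> s < u \<and> u < t + d \<longrightarrow>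
       norm (sgn (G (- u) - G (- s)) - - \<tau> (- t)) < e" using d(1) by auto
qed

text \<open>Hopf's triangle of parameter pairs, for all starting points at once. The flip
  \<open>(s, t) \<mapsto> (t, s + 1)\<close> maps the strip to itself.\<close>

definition strip :: "(real \<times> real) set" where
  "strip = {(s, t). s \<le> t \<and> t \<le> s + 1}"

text \<open>On the lines \<open>t = s\<close> and \<open>t = s + 1\<close> the chord is zero and its
  limit direction is taken. The minus sign on the second line arises because the chord from
  \<open>G s\<close> to a point just before \<open>G (s + 1)\<close> points backwards.\<close>

definition secant :: "real \<times> real \<Rightarrow> complex" where
  "secant = (\<lambda>(s, t). if t = s then \<tau> s else if t = s + 1 then - \<tau> s else sgn (G t - G s))"

lemma convex_strip: "convex strip"
proof -
  have "strip = {p. inner (1, -1) p \<le> 0} \<inter> {p. inner (-1, 1) p \<le> (1::real)}"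
    by (auto simp: strip_def inner_prod_def)
  then show ?thesis by (metis convex_Int convex_halfspace_le)
qed

lemma norm_secant: "p \<in> strip \<Longrightarrow> norm (secant p) = 1"
  using G_ne by (auto simp: strip_def secant_def norm_tangent norm_sgn) (metis order_less_le)

lemma secant_flip:
  assumes "(s, t) \<in> strip"
  shows "(t, s + 1) \<in> strip" "secant (t, s + 1) = - secant (s, t)"
proof -
  show "(t, s + 1) \<in> strip" using assms by (auto simp: strip_def)
  consider "t = s" | "t = s + 1" | "s < t" "t < s + 1" using assms by (auto simp: strip_def) argo
  then show "secant (t, s + 1) = - secant (s, t)"
  proof cases
    case 3
    then show ?thesis using sgn_minus[of "G t - G s"] by (simp add: secant_def)
  qed (auto simp: secant_def tangent_add_1)
qed

text \<open>\<open>\<tau> v\<close> is the limit of the directions of short chords starting at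
  \<open>v\<close>, and these chords also lie in the neighbourhood of \<open>t\<close>. The strict
  bound becomes weak in the limit.\<close>

lemma norm_tangent_diff_le:
  assumes "\<And>s u. t - d < s \<and> s < u \<and> u < t + d \<Longrightarrow> norm (sgn (G u - G s) - \<tau> t) < e"
    and "\<bar>v - t\<bar> < d"
  shows "norm (\<tau> v - \<tau> t) \<le> e"
proof (rule field_le_epsilon)
  fix k :: real assume "k > 0"
  then obtain d' where d': "d' > 0" "\<And>s u. v - d' < s \<and> s < u \<and> u < v + d' \<Longrightarrow>
       norm (sgn (G u - G s) - \<tau> v) < k" using chord_tangent[of k v] by auto
  define m where "m = min (d' / 2) ((d - \<bar>v - t\<bar>) / 2)"
  define u where "u = v + m"
  have "m > 0" "m < d'" "m < d - \<bar>v - t\<bar>"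
    using d'(1) assms(2) unfolding m_def by (auto simp: min_def)
  then have "v < u" "u < v + d'" "t - d < v" "u < t + d" 
    unfolding u_def by auto
  then have "norm (sgn (G u - G v) - \<tau> v) < k" "norm (sgn (G u - G v) - \<tau> t) < e"
    using d' assms(1) by auto
  then show "norm (\<tau> v - \<tau> t) \<le> e + k" by norm
qed

lemma secant_near_diagonal:
  assumes "e > 0"
  shows "\<exists>d>0. \<forall>s u. t - d < s \<and> s \<le> u \<and> u < t + d \<longrightarrow> norm (secant (s, u) - \<tau> t) < e"
proof -
  obtain d where d: "d > 0" "\<And>s u. t - d < s \<and> s < u \<and> u < t + d \<Longrightarrow>
       norm (sgn (G u - G s) - \<tau> t) < e / 2" using chord_tangent[of "e / 2" t] assms by auto
  \<comment> \<open>The bound 1/2 gives \<open>u < s + 1\<close>, which keeps the pair off the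
    second boundary line.\<close>
  define d' where "d' = min d (1/2)"
  have "norm (secant (s, u) - \<tau> t) < e" if "t - d' < s \<and> s \<le> u \<and> u < t + d'" for s u
  proof (cases "s = u")
    case True
    then have "norm (\<tau> s - \<tau> t) \<le> e / 2" 
      using that by (intro norm_tangent_diff_le[OF d(2)]) (auto simp: d'_def)
    then show ?thesis using True assms by (simp add: secant_def)
  next
    case False
    then have "s < u" "u < s + 1" using that by (auto simp: d'_def)
    then have "secant (s, u) = sgn (G u - G s)" by (auto simp: secant_def)
    moreover have "norm (sgn (G u - G s) - \<tau> t) < e / 2"
      using that \<open>s < u\<close> by (intro d(2)) (auto simp: d'_def)
    ultimately show ?thesis using assms by simp
  qed
  then show ?thesis using d(1) by (intro exI[of _ d']) (auto simp: d'_def)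
qed

lemma continuous_secant: "continuous_on strip secant"
proof -
  have "\<exists>d>0. \<forall>q\<in>strip. dist q p < d \<longrightarrow> dist (secant q) (secant p) < e" 
    if pS: "p \<in> strip" and e: "e > 0" for p e
  proof -
    obtain s t where p: "p = (s, t)" by (cases p)
    then consider "t = s" | "t = s + 1" | "s < t" "t < s + 1" using pS by (auto simp: strip_def) argo
    then show ?thesis
    proof cases
      case 1
      obtain d where d: "d > 0" "\<And>s u. t - d < s \<and> s \<le> u \<and> u < t + d \<Longrightarrow> norm (secant (s, u) - \<tau> t) < e"
        using secant_near_diagonal[OF e, of t] by blast
      have "dist (secant q) (secant p) < e" if "q \<in> strip" "dist q p < d" for q
      proof -
        have "dist (fst q) (fst p) < d" "dist (snd q) (snd p) < d"
          using dist_fst_le[of q p] dist_snd_le[of q p] that(2) by linarith+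
        then have "norm (secant (fst q, snd q) - \<tau> t) < e"
          using that(1) 1 p by (intro d(2)) (auto simp: strip_def dist_real_def)
        then show ?thesis using 1 p by (simp add: secant_def dist_norm)
      qed
      then show ?thesis using d(1) by blast
    next
      \<comment> \<open>Near the line \<open>t = s + 1\<close> the flip carries
        \<open>(b - 1, a)\<close> to \<open>(a, b)\<close>, so continuity is inherited from the
        diagonal at \<open>s\<close>.\<close>
      case 2
      obtain d where d: "d > 0" "\<And>s' u. s - d < s' \<and> s' \<le> u \<and> u < s + d \<Longrightarrow> norm (secant (s', u) - \<tau> s) < e"
        using secant_near_diagonal[OF e, of s] by blast
      have "dist (secant q) (secant p) < e" if "q \<in> strip" "dist q p < d" for q
      proof -
        obtain a b where q: "q = (a, b)" by (cases q)
        have "dist (fst q) (fst p) < d" "dist (snd q) (snd p) < d"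
          using dist_fst_le[of q p] dist_snd_le[of q p] that(2) by linarith+
        then have *: "\<bar>a - s\<bar> < d" "\<bar>b - (s + 1)\<bar> < d" using p q 2 by (auto simp: dist_real_def)
        have ab: "(b - 1, a) \<in> strip" using that(1) q by (auto simp: strip_def)
        have "secant q = - secant (b - 1, a)" using secant_flip(2)[OF ab] q by simp
        moreover have "norm (secant (b - 1, a) - \<tau> s) < e"
          using * ab by (intro d(2)) (auto simp: strip_def)
        moreover have "secant p = - \<tau> s" using p 2 by (simp add: secant_def)
        ultimately show ?thesis by (simp add: dist_norm norm_minus_commute)
      qed
      then show ?thesis using d(1) by blast
    next
      case 3
      define U where "U = {p::real \<times> real. fst p < snd p \<and> snd p < fst p + 1}"
      have U: "open U" unfolding U_def
        by (intro open_Collect_conj open_Collect_less continuous_intros)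
      have "continuous_on U (\<lambda>p. sgn (G (snd p) - G (fst p)))"
        using G_ne by (intro continuous_intros) (force simp: U_def)
      then have "continuous_on U secant"
        by (rule continuous_on_eq) (auto simp: U_def secant_def)
      moreover have "p \<in> U" using 3 p by (simp add: U_def)
      ultimately have "isCont secant p" using U continuous_on_eq_continuous_at by blast
      then show ?thesis using e unfolding continuous_at_eps_delta by meson
    qed
  qed
  then show ?thesis unfolding continuous_on_iff by blast
qed

text \<open>The flip negates the secant, so it changes the angle by an odd multiple of pi, the same
  one everywhere since the strip is connected. Which one it is depends on the curve and is found
  later from winding numbers.\<close>

lemma secant_lift:
  obtains \<Theta> M where "continuous_on strip \<Theta>" "\<And>p. p \<in> strip \<Longrightarrow> secant p = cis (\<Theta> p)"
    and "\<And>s t. (s, t) \<in> strip \<Longrightarrow> \<Theta> (t, s + 1) = \<Theta> (s, t) + M"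
proof -
  obtain \<Theta> where \<Theta>: "continuous_on strip \<Theta>" "\<And>p. p \<in> strip \<Longrightarrow> secant p = cis (\<Theta> p)"
    using cis_lift_exists[OF convex_strip continuous_secant norm_secant] by blast
  define D where "D p = \<Theta> (snd p, fst p + 1) - \<Theta> p" for p :: "real \<times> real"
  have flip: "(snd p, fst p + 1) \<in> strip" if "p \<in> strip" for p
    using that by (auto simp: strip_def)
  have "D p = D q" if "p \<in> strip" "q \<in> strip" for p q
  proof (rule cis_lift_constant[OF convex_connected[OF convex_strip], where c = "-1"])
    show "continuous_on strip D"
      unfolding D_def
      by (intro continuous_intros \<Theta>(1) continuous_on_compose2[OF \<Theta>(1)]) (use flip in auto)
    fix x assume x: "x \<in> strip"
    have "secant (snd x, fst x + 1) = - secant x" using secant_flip(2)[of "fst x" "snd x"] x by simp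
    then show "cis (D x) = -1"
      using \<Theta>(2)[OF flip[OF x]] \<Theta>(2)[OF x] 
      by (simp add: D_def cis_divide[symmetric])
  qed (use that in auto)
  moreover have "(0, 0) \<in> strip" by (simp add: strip_def)
  ultimately have "\<Theta> (t, s + 1) = \<Theta> (s, t) + D (0, 0)" if "(s, t) \<in> strip" for s t
    using that unfolding D_def by (metis add_diff_cancel_left' diff_add_cancel fst_conv snd_conv add.commute)
  then show ?thesis using that \<Theta> by blast
qed

end

section \<open>Secants between points of a circular arc\<close>

lemma chord_eq: "cis y - cis x = of_real (2 * sin ((y - x) / 2)) * cis ((x + y) / 2 + pi / 2)"
proof -
  define a b where "a = (x + y) / 2" and "b = (y - x) / 2"
  have *: "y = a + b" "x = a - b" by (auto simp: a_def b_def field_simps)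
  have "(y - x) / 2 = b" "(x + y) / 2 = a" by (auto simp: a_def b_def)
  then show ?thesis unfolding * 
    by (simp add: complex_eq_iff cos_add sin_add cos_diff sin_diff)
qed

text \<open>A chord spanning less than one turn is parallel to the tangent at the middle polar
  angle; \<open>sin ((y - x) / 2) > 0\<close> fixes the sign. The direction angle is thus linear in
  both ends.\<close>

lemma sgn_chord:
  assumes "x < y" "y < x + 2 * pi" "r > 0"
  shows "sgn ((c + of_real r * cis y) - (c + of_real r * cis x)) = cis ((x + y) / 2 + pi / 2)"
proof -
  have "(c + of_real r * cis y) - (c + of_real r * cis x) = of_real r * (cis y - cis x)"
    by (simp add: algebra_simps)
  also have "\<dots> = of_real (r * (2 * sin ((y - x) / 2))) * cis ((x + y) / 2 + pi / 2)"
    by (simp only: chord_eq of_real_mult mult.assoc)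
  also have "sgn \<dots> = cis ((x + y) / 2 + pi / 2)"
  proof -
    have "sin ((y - x) / 2) > 0" using assms by (intro sin_gt_zero) auto
    then have "r * (2 * sin ((y - x) / 2)) > 0" using assms by simp
    then have "sgn (complex_of_real (r * (2 * sin ((y - x) / 2)))) = 1"
      unfolding sgn_of_real by (metis sgn_pos of_real_1)
    then show ?thesis by (simp only: sgn_mult) (simp add: sgn_eq)
  qed
  finally show ?thesis .
qed

text \<open>A counterclockwise arc that the curve runs through in the same direction:
  \<open>\<psi>\<close> converts polar angle into curve parameter. \<open>psi_le\<close> keeps the
  arc within one period, with equality when a full circle is the whole curve.\<close>

locale loop_arc = tangent_loop +
  fixes c :: complex and r s \<alpha> :: real and \<psi> :: "real \<Rightarrow> real"
  assumes r_pos: "0 < r" and angle_pos: "0 < \<alpha>" and angle_le: "\<alpha> \<le> 2 * pi"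
    and continuous_psi: "continuous_on {s..s + \<alpha>} \<psi>"
    and mono_psi: "strict_mono_on {s..s + \<alpha>} \<psi>"
    and G_psi: "x \<in> {s..s + \<alpha>} \<Longrightarrow> G (\<psi> x) = c + of_real r * cis x"
    and psi_le: "\<psi> (s + \<alpha>) \<le> \<psi> s + 1"
begin

definition arc_pairs :: "(real \<times> real) set" where
  "arc_pairs = {(x, y). s \<le> x \<and> x \<le> y \<and> y \<le> s + \<alpha>}"

lemma psi_less: "s \<le> x \<Longrightarrow> x < y \<Longrightarrow> y \<le> s + \<alpha> \<Longrightarrow> \<psi> x < \<psi> y"
  using mono_psi by (auto simp: strict_mono_on_def)

lemma psi_leq: "s \<le> x \<Longrightarrow> x \<le> y \<Longrightarrow> y \<le> s + \<alpha> \<Longrightarrow> \<psi> x \<le> \<psi> y"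
  using psi_less[of x y] by fastforce

lemma convex_arc_pairs: "convex arc_pairs"
proof -
  have "arc_pairs = {p. inner (-1, 0) p \<le> -s} \<inter> ({p. inner (1, -1) p \<le> 0} \<inter> {p. inner (0, 1) p \<le> s + \<alpha>})"
    by (auto simp: arc_pairs_def inner_prod_def)
  then show ?thesis by (metis convex_Int convex_halfspace_le)
qed

lemma psi_strip: "(x, y) \<in> arc_pairs \<Longrightarrow> (\<psi> x, \<psi> y) \<in> strip"
  using psi_leq[of x y] psi_leq[of s x] psi_leq[of y "s + \<alpha>"] psi_le
  by (auto simp: strip_def arc_pairs_def)

text \<open>For \<open>s < x < y < s + \<alpha>\<close> this is the chord formula. The boundary of
  the triangle, with the tangents on the diagonal and the coinciding ends of a full circle, follows
  by continuity of both sides.\<close>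

lemma arc_secant:
  assumes "p \<in> arc_pairs"
  shows "secant (\<psi> (fst p), \<psi> (snd p)) = cis ((fst p + snd p) / 2 + pi / 2)"
proof -
  define f where "f q = secant (\<psi> (fst q), \<psi> (snd q)) - cis ((fst q + snd q) / 2 + pi / 2)" for q
  have "continuous_on arc_pairs (\<lambda>q. (\<psi> (fst q), \<psi> (snd q)))"
    by (intro continuous_intros continuous_on_compose2[OF continuous_psi])
      (auto simp: arc_pairs_def)
  then have "continuous_on arc_pairs (\<lambda>q. secant (\<psi> (fst q), \<psi> (snd q)))"
    by (rule continuous_on_compose2[OF continuous_secant]) (auto dest: psi_strip)
  then have f: "continuous_on arc_pairs f"
    unfolding f_def by (intro continuous_intros continuous_on_cis) auto
  have zero: "f (x, y) = 0" if "s < x" "x < y" "y < s + \<alpha>" for x y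
  proof -
    have "\<psi> x < \<psi> y" "\<psi> s < \<psi> x" "\<psi> y < \<psi> (s + \<alpha>)" using that by (auto intro!: psi_less)
    then have "secant (\<psi> x, \<psi> y) = sgn (G (\<psi> y) - G (\<psi> x))" 
      using psi_le by (auto simp: secant_def)
    also have "\<dots> = cis ((x + y) / 2 + pi / 2)"
    proof -
      have "G (\<psi> x) = c + of_real r * cis x" "G (\<psi> y) = c + of_real r * cis y"
        using that by (auto intro!: G_psi)
      moreover have "sgn ((c + of_real r * cis y) - (c + of_real r * cis x)) = cis ((x + y) / 2 + pi / 2)"
        using that angle_le by (intro sgn_chord r_pos) auto
      ultimately show ?thesis by simp
    qed
    finally show ?thesis by (simp add: f_def)
  qed
  \<comment> \<open>An inner point of the triangle: on the segment from \<open>p\<close> to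
    \<open>m\<close> only \<open>p\<close> can lie on the boundary, so \<open>f\<close> vanishes at
    \<open>p\<close> as a limit of zeros.\<close>
  define m where "m = (s + \<alpha> / 3, s + 2 * \<alpha> / 3)"
  define l where "l u = (1 - u) *\<^sub>R p + u *\<^sub>R m" for u
  have m: "m \<in> arc_pairs" using angle_pos by (auto simp: m_def arc_pairs_def)
  have cl: "closure {0<..<1} = {0..1::real}" by simp
  have "continuous_on {0..1} (\<lambda>u. f (l u))"
  proof (rule continuous_on_compose2[OF f])
    show "continuous_on {0..1} l" unfolding l_def by (intro continuous_intros)
    show "l ` {0..1} \<subseteq> arc_pairs" 
      using convexD[OF convex_arc_pairs assms m] by (auto simp: l_def)
  qed
  moreover have "f (l u) = 0" if "u \<in> {0<..<1}" for u
  proof -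
    obtain x y where p: "p = (x, y)" by (cases p)
    have xy: "s \<le> x" "x \<le> y" "y \<le> s + \<alpha>" using assms p by (auto simp: arc_pairs_def)
    define v where "v = 1 - u"
    have uv: "u > 0" "v > 0" "u = 1 - v" using that by (auto simp: v_def)
    have l: "l u = (v * x + u * (s + \<alpha> / 3), v * y + u * (s + 2 * \<alpha> / 3))"
      by (simp add: l_def p m_def v_def)
    have "v * s \<le> v * x" "v * x \<le> v * y" "v * y \<le> v * (s + \<alpha>)" "u * \<alpha> > 0"
      using xy uv angle_pos by (auto intro: mult_left_mono)
    moreover have "s = v * s + u * s" "s + \<alpha> = v * (s + \<alpha>) + u * s + u * \<alpha>" 
      unfolding uv(3) by (simp_all add: algebra_simps)
    ultimately show ?thesis unfolding l
      by (intro zero) (simp_all add: algebra_simps)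
  qed
  ultimately have "f (l 0) = 0"
    using continuous_constant_on_closure[of "{0<..<1}" "\<lambda>u. f (l u)" 0 0] by (simp add: cl)
  then show ?thesis by (simp add: f_def l_def)
qed

text \<open>Along the arc, \<open>\<Theta>\<close> is half the sum of the polar angles up to a
  constant. Moving one end of a secant turns it by half the polar angle, as in the inscribed angle
  theorem.\<close>

lemma arc_lift:
  assumes "continuous_on strip \<Theta>" "\<And>p. p \<in> strip \<Longrightarrow> secant p = cis (\<Theta> p)"
    and "(x, y) \<in> arc_pairs" "(x', y') \<in> arc_pairs"
  shows "\<Theta> (\<psi> x, \<psi> y) - \<Theta> (\<psi> x', \<psi> y') = ((x + y) - (x' + y')) / 2"
proof -
  have "continuous_on arc_pairs (\<lambda>q. (\<psi> (fst q), \<psi> (snd q)))"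
    by (intro continuous_intros continuous_on_compose2[OF continuous_psi])
      (auto simp: arc_pairs_def)
  then have c: "continuous_on arc_pairs (\<lambda>q. \<Theta> (\<psi> (fst q), \<psi> (snd q)))"
    by (rule continuous_on_compose2[OF assms(1)]) (auto dest: psi_strip)
  have "\<Theta> (\<psi> (fst (x, y)), \<psi> (snd (x, y))) - \<Theta> (\<psi> (fst (x', y')), \<psi> (snd (x', y'))) =
      (fst (x, y) + snd (x, y)) / 2 - (fst (x', y') + snd (x', y')) / 2"
  proof (rule cis_lift_diff_eq[OF convex_connected[OF convex_arc_pairs] c, where c = "cis (pi / 2)"])
    show "continuous_on arc_pairs (\<lambda>q. (fst q + snd q) / 2)" by (intro continuous_intros) auto
    fix q assume q: "q \<in> arc_pairs"
    then have "(\<psi> (fst q), \<psi> (snd q)) \<in> strip" using psi_strip[of "fst q" "snd q"] by simp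
    then show "cis (\<Theta> (\<psi> (fst q), \<psi> (snd q))) = cis (pi / 2) * cis ((fst q + snd q) / 2)"
      using arc_secant[OF q] assms(2) by (metis cis_mult add.commute)
  qed (use assms in auto)
  then show ?thesis by (simp add: diff_divide_distrib)
qed

lemma arc_turning:
  assumes "continuous_on UNIV \<theta>" "\<And>t. \<tau> t = cis (\<theta> t)"
  shows "\<theta> (\<psi> (s + \<alpha>)) - \<theta> (\<psi> s) = \<alpha>"
proof -
  have "\<theta> (\<psi> (s + \<alpha>)) - \<theta> (\<psi> s) = (s + \<alpha>) - s"
  proof (rule cis_lift_diff_eq[where S = "{s..s + \<alpha>}" and c = "cis (pi / 2)"])
    show "continuous_on {s..s + \<alpha>} (\<lambda>x. \<theta> (\<psi> x))"
      by (rule continuous_on_compose2[OF assms(1) continuous_psi]) auto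
    fix x assume "x \<in> {s..s + \<alpha>}"
    then have "(x, x) \<in> arc_pairs" by (auto simp: arc_pairs_def)
    from arc_secant[OF this] have "cis (\<theta> (\<psi> x)) = cis ((x + x) / 2 + pi / 2)"
      using assms(2) by (simp add: secant_def)
    also have "(x + x) / 2 + pi / 2 = pi / 2 + x" by simp
    finally show "cis (\<theta> (\<psi> x)) = cis (pi / 2) * cis x" by (simp only: cis_mult)
  qed (use angle_pos in simp_all)
  then show ?thesis by simp
qed

end

section \<open>Winding numbers of pieces of paths\<close>

lemma winding_number_subpath_add:
  fixes f :: "real \<Rightarrow> complex"
  assumes "continuous_on UNIV f" "z \<notin> f ` {a..c}" "a \<le> b" "b \<le> c"
  shows "winding_number (subpath a b f) z + winding_number (subpath b c f) z = winding_number (subpath a c f) z"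
proof (cases "a = c")
  case True
  then show ?thesis using assms by auto
next
  case False
  then have ac: "a < c" using assms by simp
  define g where "g = subpath a c f"
  \<comment> \<open>The position of \<open>b\<close> within \<open>{a..c}\<close>, rescaled to the
    unit interval, at which \<open>g\<close> is split.\<close>
  define v where "v = (b - a) / (c - a)"
  have v: "v * (c - a) = b - a" "v \<in> {0..1}" using ac assms by (auto simp: v_def field_simps)
  have f: "continuous_on S f" for S using assms(1) continuous_on_subset by blast
  have g: "path g" using f by (simp add: g_def path_subpath path_def continuous_on_subset[OF assms(1)] subpath_def)
      (intro continuous_on_compose2[OF assms(1)] continuous_intros, auto)
  have "path_image g = f ` {a..c}" unfolding g_def using ac by (simp add: path_image_subpath)
  then have z: "z \<notin> path_image g" using assms(2) by simp
  have "(c - a) * ((v - 0) * x + 0) + a = (b - a) * x + a" 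
    "(c - a) * ((1 - v) * x + v) + a = (c - b) * x + b" for x
  proof -
    have "(c - a) * ((v - 0) * x + 0) + a = (v * (c - a)) * x + a" by (simp add: algebra_simps)
    then show "(c - a) * ((v - 0) * x + 0) + a = (b - a) * x + a" using v by simp
    have "(c - a) * ((1 - v) * x + v) + a = (c - a) * x - (v * (c - a)) * x + v * (c - a) + a" by (simp add: algebra_simps)
    then show "(c - a) * ((1 - v) * x + v) + a = (c - b) * x + b" unfolding v by (simp add: algebra_simps)
  qed
  then have "subpath 0 v g = subpath a b f" "subpath v 1 g = subpath b c f"
    unfolding g_def subpath_def by (simp_all only:)
  with winding_number_subpath_combine[OF g z, of 0 v 1] v(2) show ?thesis
    by (simp add: g_def)
qed

text \<open>With a multiple \<open>m\<close> of the period such that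
  \<open>m \<le> a \<le> m + p\<close>, moving the piece from \<open>m\<close> to \<open>a\<close>
  one period ahead turns a period starting at \<open>m\<close> into one starting at
  \<open>a\<close>.\<close>

lemma winding_number_periodic:
  fixes f :: "real \<Rightarrow> complex"
  assumes "continuous_on UNIV f" "z \<notin> range f" "p > 0" "\<And>x. f (x + p) = f x"
  shows "winding_number (subpath a (a + p) f) z = winding_number (subpath 0 p f) z"
proof -
  have nat: "f (x + of_nat k * p) = f x" for x k
  proof (induction k)
    case (Suc k)
    then show ?case using assms(4)[of "x + of_nat k * p"] by (simp add: algebra_simps)
  qed simp
  have int: "f (x + of_int k * p) = f x" for x k
  proof (cases k)
    case (nonneg n) then show ?thesis using nat by simp
  next
    case (neg n)
    then have "x + of_int k * p = x - of_nat (Suc n) * p" unfolding neg by (simp add: algebra_simps)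
    then show ?thesis using nat[of "x - of_nat (Suc n) * p" "Suc n"] by simp
  qed
  have sub: "subpath (x + of_int k * p) (y + of_int k * p) f = subpath x y f" for x y k
  proof -
    have "(y + of_int k * p - (x + of_int k * p)) * u + (x + of_int k * p) = ((y - x) * u + x) + of_int k * p" for u
      by simp
    then show ?thesis unfolding subpath_def by (simp only: int)
  qed
  define k where "k = \<lfloor>a / p\<rfloor>"
  define m where "m = of_int k * p"
  have m: "m \<le> a" "a \<le> m + p"
  proof -
    have "of_int k \<le> a / p" "a / p \<le> of_int k + 1" unfolding k_def by linarith+
    then show "m \<le> a" "a \<le> m + p" using assms(3) by (simp_all add: m_def field_simps)
  qed
  have "winding_number (subpath a (m + p) f) z + winding_number (subpath (m + p) (a + p) f) z = winding_number (subpath a (a + p) f) z"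
    using m assms by (intro winding_number_subpath_add) auto
  moreover have "subpath (m + p) (a + p) f = subpath m a f" using sub[of m 1 a] by simp
  moreover have "winding_number (subpath m a f) z + winding_number (subpath a (m + p) f) z = winding_number (subpath m (m + p) f) z"
    using m assms by (intro winding_number_subpath_add) auto
  moreover have "subpath m (m + p) f = subpath 0 p f" using sub[of 0 k p] by (simp add: m_def add.commute)
  ultimately show ?thesis by (metis add.commute)
qed

text \<open>The path may be open. The imaginary part of the continuous logarithm of
  \<open>g - z\<close> is another angle of the same direction, so both change by the same amount;
  the real part of the winding number records this change.\<close>

lemma winding_number_angle:
  assumes "path g" "z \<notin> path_image g" "continuous_on {0..1} \<theta>"
    and "\<And>t. t \<in> {0..1} \<Longrightarrow> sgn (g t - z) = cis (\<theta> t)"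
  shows "2 * pi * Re (winding_number g z) = \<theta> 1 - \<theta> 0"
proof -
  obtain q where q: "path q" "pathfinish q - pathstart q = 2 * of_real pi * \<i> * winding_number g z"
    "\<And>t. t \<in> {0..1} \<Longrightarrow> g t = z + exp (q t)"
    using winding_number_as_continuous_log[OF assms(1,2)] by metis
  have "2 * pi * Re (winding_number g z) = Im (pathfinish q - pathstart q)"
    unfolding q(2) by simp
  also have "\<dots> = Im (q 1) - Im (q 0)" by (simp add: pathfinish_def pathstart_def)
  also have "\<dots> = \<theta> 1 - \<theta> 0"
  proof (rule cis_lift_diff_eq[where S = "{0..1}" and c = 1])
    show "continuous_on {0..1} (\<lambda>t. Im (q t))" using q(1) by (intro continuous_intros) (simp add: path_def)
    fix t :: real assume "t \<in> {0..1}"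
    then have "cis (\<theta> t) = sgn (exp (q t))" using assms(4) q(3) by (metis add_diff_cancel_left')
    also have "\<dots> = cis (Im (q t))" by (simp add: exp_eq_polar sgn_mult sgn_eq norm_mult)
    finally show "cis (Im (q t)) = 1 * cis (\<theta> t)" by simp
  qed (use assms in auto)
  finally show ?thesis .
qed

lemma subpath_eq_part_circlepath: "subpath a b (\<lambda>x. c + of_real r * cis x) = part_circlepath c r a b"
  by (auto simp: subpath_def part_circlepath_def linepath_def cis_conv_exp algebra_simps)

lemma winding_number_full_circle:
  assumes "r > 0" "dist z c \<noteq> r"
  shows "winding_number (part_circlepath c r a (a + 2 * pi)) z = (if z \<in> ball c r then 1 else 0)"
proof -
  define f where "f x = c + of_real r * cis x" for x
  have "continuous_on UNIV f" unfolding f_def by (intro continuous_intros continuous_on_cis)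
  moreover have "z \<notin> range f" using assms by (auto simp: f_def dist_norm norm_mult)
  moreover have "f (x + 2 * pi) = f x" for x by (simp add: f_def flip: cis_mult)
  ultimately have "winding_number (subpath a (a + 2 * pi) f) z = winding_number (subpath 0 (2 * pi) f) z"
    by (intro winding_number_periodic) auto
  then have *: "winding_number (part_circlepath c r a (a + 2 * pi)) z = winding_number (circlepath c r) z"
    unfolding f_def subpath_eq_part_circlepath by (simp add: circlepath_def)
  show ?thesis
  proof (cases "z \<in> ball c r")
    case True
    then show ?thesis unfolding * by (simp add: winding_number_circlepath dist_norm norm_minus_commute)
  next
    case False
    then have "z \<notin> cball c r" using assms by (simp add: dist_commute)
    moreover have "path_image (circlepath c r) \<subseteq> cball c r" using assms by simp
    ultimately have "winding_number (circlepath c r) z = 0"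
      by (intro winding_number_zero_outside[of _ "cball c r"]) auto
    then show ?thesis unfolding * using False by simp
  qed
qed

context tangent_loop
begin

text \<open>One period of the tangent amounts to two flips: \<open>(t, t)\<close> goes to
  \<open>(t, t + 1)\<close> and then to \<open>(t + 1, t + 1)\<close>.\<close>

lemma total_turning:
  assumes "continuous_on strip \<Theta>" "\<And>p. p \<in> strip \<Longrightarrow> secant p = cis (\<Theta> p)"
    and "\<And>s t. (s, t) \<in> strip \<Longrightarrow> \<Theta> (t, s + 1) = \<Theta> (s, t) + M"
    and "continuous_on UNIV \<theta>" "\<And>t. \<tau> t = cis (\<theta> t)"
  shows "\<theta> (t + 1) - \<theta> t = 2 * M"
proof -
  have "\<theta> (t + 1) - \<theta> t = \<Theta> (t + 1, t + 1) - \<Theta> (t, t)"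
  proof (rule cis_lift_diff_eq[where S = UNIV and c = 1])
    show "continuous_on UNIV (\<lambda>t. \<Theta> (t, t))"
      by (rule continuous_on_compose2[OF assms(1)]) (auto simp: strip_def intro!: continuous_intros)
    fix t :: real
    have "secant (t, t) = cis (\<Theta> (t, t))" by (rule assms(2)) (simp add: strip_def)
    then show "cis (\<theta> t) = 1 * cis (\<Theta> (t, t))" by (simp add: secant_def assms(5))
  qed (use assms in auto)
  also have "\<Theta> (t + 1, t + 1) = \<Theta> (t, t + 1) + M" using assms(3)[of t "t + 1"] by (simp add: strip_def)
  also have "\<Theta> (t, t + 1) = \<Theta> (t, t) + M" using assms(3)[of t t] by (simp add: strip_def)
  finally show ?thesis by simp
qed

lemma tangent_lift:
  obtains \<theta> where "continuous_on UNIV \<theta>" "\<And>t. \<tau> t = cis (\<theta> t)"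
proof -
  obtain \<Theta> M where T: "continuous_on strip \<Theta>" "\<And>p. p \<in> strip \<Longrightarrow> secant p = cis (\<Theta> p)"
    using secant_lift by metis
  show ?thesis
  proof
    show "continuous_on UNIV (\<lambda>t. \<Theta> (t, t))"
      by (rule continuous_on_compose2[OF T(1)]) (auto simp: strip_def intro!: continuous_intros)
    show "\<tau> t = cis (\<Theta> (t, t))" for t using T(2)[of "(t, t)"] by (simp add: strip_def secant_def)
  qed
qed

lemma path_subpath_G: "path (subpath a b G)"
  unfolding path_def subpath_def by (intro continuous_intros)

end

lemma interpolate_mem:
  fixes x y t :: real
  assumes "x \<le> y" "t \<in> {0..1}"
  shows "(y - x) * t + x \<in> {x..y}"
proof -
  have "(y - x) * t \<le> y - x" "0 \<le> (y - x) * t" using assms by (auto intro!: mult_left_le)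
  then show ?thesis unfolding atLeastAtMost_iff by linarith
qed
lemma point_on_circle:
  assumes "dist z c = r"
  obtains y where "y \<in> {s..s + 2 * pi}" "z = c + of_real r * cis y"
proof -
  define u where "u = Arg (z - c)"
  define k where "k = \<lfloor>(u - s) / (2 * pi)\<rfloor>"
  define y where "y = u - 2 * pi * of_int k"
  have "of_int k \<le> (u - s) / (2 * pi)" "(u - s) / (2 * pi) \<le> of_int k + 1" unfolding k_def by linarith+
  then have "y \<in> {s..s + 2 * pi}" using pi_gt_zero by (simp add: y_def field_simps)
  moreover have "cis y = cis u" by (simp add: y_def cis_multiple_2pi flip: cis_divide)
  moreover have "z - c = of_real r * cis u"
    using rcis_cmod_Arg[of "z - c"] assms by (simp add: rcis_def dist_norm u_def)
  ultimately show ?thesis using that[of y] by (simp add: algebra_simps)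
qed

text \<open>Rescaled to the unit interval, \<open>\<phi>\<close> is a reparametrization fixing both
  ends, and homotopy invariance allows it to move back and forth. A constant \<open>\<phi>\<close>,
  where rescaling would divide by zero, is a separate case.\<close>

lemma winding_number_subpath_reparam:
  assumes "continuous_on UNIV f" "continuous_on {x..y} \<phi>" "x < y" "\<phi> x \<le> \<phi> y"
    and "\<And>t. t \<in> {x..y} \<Longrightarrow> \<phi> t \<in> {\<phi> x..\<phi> y}"
    and "\<And>t. t \<in> {x..y} \<Longrightarrow> g t = f (\<phi> t)" "z \<notin> f ` {\<phi> x..\<phi> y}"
  shows "winding_number (subpath x y g) z = winding_number (subpath (\<phi> x) (\<phi> y) f) z"
proof (cases "\<phi> x = \<phi> y")
  case True
  have *: "subpath x y g t = f (\<phi> y)" if "0 \<le> t" "t \<le> 1" for t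
  proof -
    have "(y - x) * t + x \<in> {x..y}" using that assms(3) by (intro interpolate_mem) auto
    from assms(5)[OF this] assms(6)[OF this] show ?thesis using True unfolding subpath_def by simp
  qed
  have "winding_number (subpath x y g) z = 0"
    using assms(7) True by (intro winding_number_constI[OF _ *]) auto
  then show ?thesis using True assms(7) by simp
next
  case False
  with assms(4) have lt: "\<phi> x < \<phi> y" by simp
  have xy: "(y - x) * t + x \<in> {x..y}" if "t \<in> {0..1}" for t
    using that assms(3) by (intro interpolate_mem) auto
  define \<sigma> where "\<sigma> t = (\<phi> ((y - x) * t + x) - \<phi> x) / (\<phi> y - \<phi> x)" for t
  have "homotopic_paths (- {z}) (subpath (\<phi> x) (\<phi> y) f) (subpath x y g)"
  proof (rule homotopic_paths_reparametrize[where f = \<sigma>])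
    show "path (subpath (\<phi> x) (\<phi> y) f)"
      unfolding path_def subpath_def 
      by (intro continuous_on_compose2[OF assms(1)] continuous_intros) auto
    show "path_image (subpath (\<phi> x) (\<phi> y) f) \<subseteq> - {z}"
      using assms(7) lt by (auto simp: path_image_subpath)
    show "continuous_on {0..1} \<sigma>" unfolding \<sigma>_def
      using lt xy by (intro continuous_intros continuous_on_compose2[OF assms(2)]) auto
    show "\<sigma> \<in> {0..1} \<rightarrow> {0..1}"
      using lt assms(5)[OF xy] by (auto simp: \<sigma>_def field_simps)
    show "\<sigma> 0 = 0" "\<sigma> 1 = 1" using lt by (auto simp: \<sigma>_def)
    show "subpath x y g t = subpath (\<phi> x) (\<phi> y) f (\<sigma> t)" if "t \<in> {0..1}" for t
      using lt assms(6)[OF xy[OF that]] by (simp add: \<sigma>_def subpath_def)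
  qed
  then show ?thesis using winding_number_homotopic_paths by metis
qed

lemma part_circlepath_avoids:
  assumes "r > 0" "s < x" "x < s + \<alpha>" "\<alpha> \<le> 2 * pi"
  shows "c + of_real r * cis x \<notin> path_image (part_circlepath c r (s + \<alpha>) (s + 2 * pi))"
proof
  assume "c + of_real r * cis x \<in> path_image (part_circlepath c r (s + \<alpha>) (s + 2 * pi))"
  then obtain y where y: "s + \<alpha> \<le> y" "y \<le> s + 2 * pi" "c + of_real r * cis x = c + of_real r * cis y"
    using assms by (auto simp: path_image_part_circlepath' closed_segment_eq_real_ivl)
  have "sgn ((c + of_real r * cis y) - (c + of_real r * cis x)) = cis ((x + y) / 2 + pi / 2)"
    using y assms by (intro sgn_chord) auto
  then show False unfolding y(3) by simp
qed

lemma dist_arc: "r > 0 \<Longrightarrow> dist (c + of_real r * cis x) c = r"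
  by (simp add: dist_norm norm_mult)

lemma (in tangent_loop) range_G_eq: "range G = G ` {a..a + 1}"
proof -
  have "G t \<in> G ` {a..a + 1}" for t
  proof -
    define u where "u = t - of_int \<lfloor>t - a\<rfloor>"
    have "u \<in> {a..a + 1}" unfolding u_def atLeastAtMost_iff by linarith
    moreover have "G t = G u" unfolding G_eq_iff by (simp add: u_def)
    ultimately show ?thesis by blast
  qed
  then show ?thesis by auto
qed

section \<open>The jump of the winding number across an arc\<close>

context loop_arc
begin

lemma psi_start_less_end: "\<psi> s < \<psi> (s + \<alpha>)"
  using angle_pos by (intro psi_less) auto

lemma winding_number_through_arc:
  assumes "z \<notin> range G"
  shows "winding_number G z = winding_number (part_circlepath c r s (s + \<alpha>)) z
    + winding_number (subpath (\<psi> (s + \<alpha>)) (\<psi> s + 1) G) z"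
proof -
  have "winding_number G z = winding_number (subpath 0 1 G) z" by simp
  also have "\<dots> = winding_number (subpath (\<psi> s) (\<psi> s + 1) G) z"
    using assms by (intro winding_number_periodic[symmetric] continuous_G) auto
  also have "\<dots> = winding_number (subpath (\<psi> s) (\<psi> (s + \<alpha>)) G) z
      + winding_number (subpath (\<psi> (s + \<alpha>)) (\<psi> s + 1) G) z"
    using assms psi_start_less_end psi_le by (intro winding_number_subpath_add[symmetric] continuous_G) auto
  also have "winding_number (subpath (\<psi> s) (\<psi> (s + \<alpha>)) G) z = winding_number (part_circlepath c r s (s + \<alpha>)) z"
    unfolding subpath_eq_part_circlepath[symmetric]
    using assms angle_pos psi_start_less_end psi_leq G_psi
    by (intro winding_number_subpath_reparam[symmetric] continuous_G continuous_psi) auto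
  finally show ?thesis .
qed

text \<open>
  Replacing the arc by the complementary arc of its circle gives a loop that avoids the point
  \<open>p\<close> in the arc, so its winding number \<open>k\<close> is the same at all points near \<open>p\<close>.  The winding
  number of \<open>G\<close> itself is larger than that exactly by the winding number of the full circle.
  Seen from \<open>p\<close>, the arc and the complementary arc subtend half of their central angles, which relates
  \<open>k\<close> to the angle through which the secants from \<open>p\<close> turn.
\<close>

lemma winding_number_near_arc:
  assumes x: "s < x" "x < s + \<alpha>" and \<theta>: "continuous_on UNIV \<theta>" "\<And>t. \<tau> t = cis (\<theta> t)"
  obtains k :: int and e where "e > 0" "\<theta> 1 - \<theta> 0 = 2 * pi * (2 * k + 1)"
    "\<And>z. z \<in> ball (c + of_real r * cis x) e \<Longrightarrow> z \<notin> range G \<Longrightarrow>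
       winding_number G z = of_int k + (if z \<in> ball c r then 1 else 0)"
    "\<And>z. z \<in> ball (c + of_real r * cis x) e \<Longrightarrow> z \<in> range G \<Longrightarrow> dist z c = r"
proof -
  define p where "p = c + of_real r * cis x"
  define a b where "a = \<psi> s" and "b = \<psi> (s + \<alpha>)"
  define arc rest comp where "arc = part_circlepath c r s (s + \<alpha>)"
    and "rest = subpath b (a + 1) G" and "comp = part_circlepath c r (s + \<alpha>) (s + 2 * pi)"
  have p: "p = G (\<psi> x)" unfolding p_def by (rule G_psi[symmetric]) (use x in auto)
  have ab: "a < \<psi> x" "\<psi> x < b" "b \<le> a + 1" 
    using x psi_le by (auto simp: a_def b_def intro!: psi_less)
  have "path rest" unfolding rest_def by (rule path_subpath_G)
  have "path comp" "path arc" unfolding comp_def arc_def by simp_all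
  have image_rest: "path_image rest = G ` {b..a + 1}"
    using ab by (simp add: rest_def path_image_subpath)
  have "p \<notin> path_image rest"
    unfolding image_rest p using ab G_ne[of "\<psi> x"] by (auto simp: image_iff)
  have "p \<notin> path_image comp"
    unfolding comp_def p_def by (rule part_circlepath_avoids[OF r_pos x angle_le])
  have ends: "pathstart rest = c + of_real r * cis (s + \<alpha>)" "pathfinish rest = c + of_real r * cis s"
    using angle_pos G_psi[of s] G_psi[of "s + \<alpha>"] by (auto simp: rest_def a_def b_def)
  have ends': "pathstart comp = pathstart rest" "pathfinish comp = pathfinish rest"
    unfolding ends comp_def subpath_eq_part_circlepath[symmetric] pathstart_subpath pathfinish_subpath
    by (simp_all flip: cis_mult)
  \<comment> \<open>\<open>rest\<close> and \<open>comp\<close> both run from the end of the arc to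
    its start, so the complementary arc is appended backwards.\<close>
  define loop where "loop = rest +++ reversepath comp"
  have loop: "path loop" "pathfinish loop = pathstart loop" 
    using ends' \<open>path rest\<close> \<open>path comp\<close> by (auto simp: loop_def)
  have image_loop: "path_image loop = path_image rest \<union> path_image comp"
    using ends' by (simp add: loop_def path_image_join)
  have wn_loop: "winding_number loop z = winding_number rest z - winding_number comp z"
    if "z \<notin> path_image loop" for z
    using that ends' \<open>path rest\<close> \<open>path comp\<close> unfolding image_loop 
    by (simp add: loop_def winding_number_join winding_number_reversepath)
  have "p \<notin> path_image loop" using \<open>p \<notin> path_image rest\<close> \<open>p \<notin> path_image comp\<close> image_loop by simp
  moreover have "closed (path_image loop)" using loop(1) closed_path_image by blast
  ultimately obtain e where e: "e > 0" "ball p e \<inter> path_image loop = {}"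
    by (metis ComplI disjoint_eq_subset_Compl open_Compl open_contains_ball)
  obtain k :: int where k: "winding_number loop p = of_int k"
    using integer_winding_number[OF loop \<open>p \<notin> path_image loop\<close>] by (auto elim: Ints_cases)
  show ?thesis
  proof
    show "e > 0" by (rule e)
    obtain \<Theta> M where \<Theta>: "continuous_on strip \<Theta>" "\<And>p. p \<in> strip \<Longrightarrow> secant p = cis (\<Theta> p)"
      "\<And>s t. (s, t) \<in> strip \<Longrightarrow> \<Theta> (t, s + 1) = \<Theta> (s, t) + M" using secant_lift by metis
    \<comment> \<open>Seen from \<open>p\<close>, \<open>rest\<close> is swept out by the secants
      with first parameter \<open>\<psi> x\<close> and second parameter from \<open>b\<close> to
      \<open>a + 1\<close>, all of which lie in the strip.\<close>
    have "2 * pi * Re (winding_number rest p) = \<Theta> (\<psi> x, (a + 1 - b) * 1 + b) - \<Theta> (\<psi> x, (a + 1 - b) * 0 + b)"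
    proof (rule winding_number_angle[OF \<open>path rest\<close> \<open>p \<notin> path_image rest\<close>])
      have u: "b \<le> (a + 1 - b) * t + b" "(a + 1 - b) * t + b \<le> a + 1" if "t \<in> {0..1}" for t
        using that ab interpolate_mem[of b "a + 1" t] by auto
      show "continuous_on {0..1} (\<lambda>t. \<Theta> (\<psi> x, (a + 1 - b) * t + b))"
      proof (rule continuous_on_compose2[OF \<Theta>(1)])
        show "(\<lambda>t. (\<psi> x, (a + 1 - b) * t + b)) ` {0..1} \<subseteq> strip"
        proof (intro image_subsetI)
          fix t :: real assume "t \<in> {0..1}"
          from u[OF this] ab show "(\<psi> x, (a + 1 - b) * t + b) \<in> strip" by (simp add: strip_def)
        qed
      qed (intro continuous_intros)
      fix t :: real assume "t \<in> {0..1}"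
      then have t: "\<psi> x < (a + 1 - b) * t + b" "(a + 1 - b) * t + b < \<psi> x + 1" using u[OF \<open>t \<in> {0..1}\<close>] ab by linarith+
      then have "(\<psi> x, (a + 1 - b) * t + b) \<in> strip" by (simp add: strip_def)
      then have "cis (\<Theta> (\<psi> x, (a + 1 - b) * t + b)) = secant (\<psi> x, (a + 1 - b) * t + b)"
        by (rule \<Theta>(2)[symmetric])
      also have "\<dots> = sgn (rest t - p)" using t by (simp add: secant_def rest_def subpath_def p)
      finally show "sgn (rest t - p) = cis (\<Theta> (\<psi> x, (a + 1 - b) * t + b))" by simp
    qed
    \<comment> \<open>The secant to \<open>a + 1\<close> is the flip of the secant from
      \<open>a\<close>, a chord of the arc; this brings in \<open>M\<close>.\<close>
    also have "\<dots> = \<Theta> (a, \<psi> x) + M - \<Theta> (\<psi> x, b)"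
      using \<Theta>(3)[of a "\<psi> x"] ab by (simp add: strip_def)
    also have "\<dots> = M - \<alpha> / 2"
      using arc_lift[OF \<Theta>(1,2), of s x x "s + \<alpha>"] x by (simp add: a_def b_def arc_pairs_def field_simps)
    finally have wn_rest: "2 * pi * Re (winding_number rest p) = M - \<alpha> / 2" .
    \<comment> \<open>\<open>p\<close> lies on the circle of \<open>comp\<close>, so
      \<open>sgn_chord\<close> gives the angle: half of the remaining
      \<open>2 * pi - \<alpha>\<close>.\<close>
    have "2 * pi * Re (winding_number comp p) =
      ((x + ((2 * pi - \<alpha>) * 1 + (s + \<alpha>))) / 2 + pi / 2) - ((x + ((2 * pi - \<alpha>) * 0 + (s + \<alpha>))) / 2 + pi / 2)"
    proof (rule winding_number_angle[OF \<open>path comp\<close> \<open>p \<notin> path_image comp\<close>])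
      fix t :: real assume t: "t \<in> {0..1}"
      then have u: "s + \<alpha> \<le> (2 * pi - \<alpha>) * t + (s + \<alpha>)" "(2 * pi - \<alpha>) * t + (s + \<alpha>) \<le> s + 2 * pi"
        using angle_le interpolate_mem[of "s + \<alpha>" "s + 2 * pi" t] by auto
      have "comp t = c + of_real r * cis ((2 * pi - \<alpha>) * t + (s + \<alpha>))"
        unfolding comp_def subpath_eq_part_circlepath[symmetric] by (simp add: subpath_def)
      moreover have "sgn ((c + of_real r * cis ((2 * pi - \<alpha>) * t + (s + \<alpha>))) - p) =
          cis ((x + ((2 * pi - \<alpha>) * t + (s + \<alpha>))) / 2 + pi / 2)"
        unfolding p_def using u x r_pos by (intro sgn_chord) auto
      ultimately show "sgn (comp t - p) = cis ((x + ((2 * pi - \<alpha>) * t + (s + \<alpha>))) / 2 + pi / 2)" by simp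
    qed (intro continuous_intros, simp_all)
    also have "\<dots> = pi - \<alpha> / 2" by (simp add: field_simps)
    \<comment> \<open>The terms \<open>\<alpha> / 2\<close> cancel, and since the loop is closed the
      result is \<open>2 * pi * k\<close>.\<close>
    finally have "2 * pi * Re (winding_number loop p) = M - pi"
      unfolding wn_loop[OF \<open>p \<notin> path_image loop\<close>] using wn_rest by (simp add: algebra_simps)
    then have "M = pi * (2 * k + 1)" unfolding k by (simp add: algebra_simps)
    then show "\<theta> 1 - \<theta> 0 = 2 * pi * (2 * k + 1)" using total_turning[OF \<Theta> \<theta>, of 0] by simp
    \<comment> \<open>\<open>ball p e\<close> misses \<open>rest\<close>, so near \<open>p\<close>
      the curve consists of points of the arc alone.\<close>
    show "dist z c = r" if z: "z \<in> ball (c + of_real r * cis x) e" "z \<in> range G" for z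
    proof -
      have "z \<notin> G ` {b..a + 1}" using z(1) e(2) image_loop image_rest by (auto simp: p_def)
      moreover obtain u where u: "z = G u" "a \<le> u" "u \<le> a + 1"
        using z(2) range_G_eq[of a] by auto
      ultimately have "u \<le> b" by (cases "u \<le> b") auto
      with u obtain y where "s \<le> y" "y \<le> s + \<alpha>" "\<psi> y = u"
        using IVT'[of \<psi> s u "s + \<alpha>"] angle_pos continuous_psi by (auto simp: a_def b_def)
      then show ?thesis using G_psi[of y] u(1) dist_arc[OF r_pos] by simp
    qed
    fix z assume z: "z \<in> ball (c + of_real r * cis x) e" "z \<notin> range G"
    have "winding_number loop constant_on ball p e"
      by (rule winding_number_constant[OF loop _ e(2)]) simp
    then have kz: "winding_number loop z = of_int k"
      using z(1) e(1) k unfolding constant_on_def p_def[symmetric] by (metis centre_in_ball)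
    have nz: "z \<notin> path_image loop" using e(2) z(1) by (auto simp: p_def)
    then have z_comp: "z \<notin> path_image comp" unfolding image_loop by simp
    have z_arc: "z \<notin> path_image arc"
    proof
      assume "z \<in> path_image arc"
      then obtain y where "y \<in> {s..s + \<alpha>}" "z = c + of_real r * cis y"
        using angle_pos by (auto simp: arc_def path_image_part_circlepath' closed_segment_eq_real_ivl)
      then have "z = G (\<psi> y)" using G_psi by simp
      then show False using z(2) by simp
    qed
    have E: "continuous_on UNIV (\<lambda>x. c + of_real r * cis x)" by (intro continuous_intros continuous_on_cis)
    have full: "z \<notin> (\<lambda>x. c + of_real r * cis x) ` {s..s + 2 * pi}"
    proof
      assume "z \<in> (\<lambda>x. c + of_real r * cis x) ` {s..s + 2 * pi}"
      then obtain y where "s \<le> y" "y \<le> s + 2 * pi" "z = c + of_real r * cis y" by auto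
      then have "z \<in> path_image arc \<or> z \<in> path_image comp"
        using angle_pos angle_le
        by (cases "y \<le> s + \<alpha>") (auto simp: arc_def comp_def path_image_part_circlepath' closed_segment_eq_real_ivl)
      then show False using z_arc z_comp by blast
    qed
    have "dist z c \<noteq> r"
    proof
      assume "dist z c = r"
      from point_on_circle[OF this, of s] obtain y where "y \<in> {s..s + 2 * pi}" "z = c + of_real r * cis y" .
      then show False using full by blast
    qed
    then have "winding_number (part_circlepath c r s (s + 2 * pi)) z = (if z \<in> ball c r then 1 else 0)"
      using r_pos by (intro winding_number_full_circle) auto
    moreover have "winding_number (part_circlepath c r s (s + 2 * pi)) z = winding_number arc z + winding_number comp z"
      unfolding arc_def comp_def subpath_eq_part_circlepath[symmetric]
      using angle_pos angle_le full by (intro winding_number_subpath_add[symmetric] E) auto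
    moreover have "winding_number G z = winding_number arc z + winding_number rest z"
      unfolding arc_def rest_def a_def b_def by (rule winding_number_through_arc[OF z(2)])
    \<comment> \<open>Eliminating the arc: the winding number of \<open>G\<close> is that of the
      full circle plus that of \<open>rest\<close> minus that of \<open>comp\<close>, hence the full
      circle plus \<open>loop\<close>.\<close>
    ultimately have sum: "(if z \<in> ball c r then 1 else 0) = winding_number arc z + winding_number comp z"
      and "winding_number G z = winding_number arc z + winding_number rest z" by simp_all
    then show "winding_number G z = of_int k + (if z \<in> ball c r then 1 else 0)"
      unfolding sum using kz wn_loop[OF nz] by (simp add: algebra_simps)
  qed
qed

end

context tangent_loop
begin

lemma path_image_G: "path_image G = range G"
  using range_G_eq[of 0] by (simp add: path_image_def)

lemma simple_path_G: "simple_path G" "pathfinish G = pathstart G"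
proof -
  have "path G" unfolding path_def using continuous_G continuous_on_subset by blast
  moreover have "x = y \<or> x = 0 \<and> y = 1 \<or> x = 1 \<and> y = 0" if "x \<in> {0..1}" "y \<in> {0..1}" "G x = G y" for x y
    using that G_ne[of x y] G_ne[of y x] by fastforce
  ultimately show "simple_path G" by (simp add: simple_path_def loop_free_def)
  show "pathfinish G = pathstart G" using G_add_1[of 0] by (simp add: pathfinish_def pathstart_def)
qed

lemma winding_number_zero_outside_range: "z \<in> outside (range G) \<Longrightarrow> winding_number G z = 0"
  using winding_number_zero_in_outside[of G z] simple_path_G simple_path_imp_path[of G] path_image_G by metis

end

section \<open>The enclosed region and convexity near a link\<close>

context loop_arc
begin

lemma part_circlepath_interior:
  "p \<in> path_image (link_path r (Link c s \<alpha>)) - link_ends r (Link c s \<alpha>) \<Longrightarrow>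
     \<exists>x. s < x \<and> x < s + \<alpha> \<and> p = c + of_real r * cis x"
  unfolding link_path_def link_ends_def subpath_eq_part_circlepath[symmetric] pathstart_subpath pathfinish_subpath
  using angle_pos by (auto simp: path_image_subpath) (metis order_le_less)

lemma arc_inner_not_end:
  assumes "s < x" "x < s + \<alpha>"
  shows "c + of_real r * cis x \<in> path_image (link_path r (Link c s \<alpha>)) - link_ends r (Link c s \<alpha>)"
proof -
  have "c + of_real r * cis x \<noteq> c + of_real r * cis s" 
    using sgn_chord[of s x r c] assms angle_le r_pos by auto
  moreover have "c + of_real r * cis x \<noteq> c + of_real r * cis (s + \<alpha>)" 
    using sgn_chord[of x "s + \<alpha>" r c] assms angle_le r_pos by auto
  ultimately show ?thesis
    unfolding link_path_def link_ends_def subpath_eq_part_circlepath[symmetric] pathstart_subpath pathfinish_subpath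
    using assms by (auto simp: path_image_subpath)
qed

lemma radial_points:
  assumes "e > 0"
  obtains z w where "z \<in> ball (c + of_real r * cis x) e" "dist z c < r"
    "w \<in> ball (c + of_real r * cis x) e" "dist w c > r"
proof -
  \<comment> \<open>The bound 1/2 keeps \<open>1 - \<eta>\<close> positive, and
    \<open>e / (2 * r)\<close> keeps the displacement below \<open>e\<close>.\<close>
  define \<eta> where "\<eta> = min (1 / 2) (e / (2 * r))"
  have \<eta>: "\<eta> > 0" "\<eta> < 1" "\<eta> * r < e" using assms r_pos by (auto simp: \<eta>_def min_def field_simps)
  have z: "c + of_real (r * (1 + \<delta>)) * cis x \<in> ball (c + of_real r * cis x) e"
    "dist (c + of_real (r * (1 + \<delta>)) * cis x) c = r * (1 + \<delta>)"
    if "\<delta> = \<eta> \<or> \<delta> = - \<eta>" for \<delta>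
  proof -
    have "c + of_real r * cis x - (c + of_real (r * (1 + \<delta>)) * cis x) = of_real (- r * \<delta>) * cis x"
      by (simp add: algebra_simps)
    then have "dist (c + of_real r * cis x) (c + of_real (r * (1 + \<delta>)) * cis x) = \<bar>r * \<delta>\<bar>"
      unfolding dist_norm by (simp add: norm_mult abs_mult)
    also have "\<dots> = \<eta> * r" using that \<eta> r_pos by (auto simp: abs_mult)
    finally show "c + of_real (r * (1 + \<delta>)) * cis x \<in> ball (c + of_real r * cis x) e" using \<eta> by simp
    have "dist (c + of_real (r * (1 + \<delta>)) * cis x) c = \<bar>r * (1 + \<delta>)\<bar>"
      unfolding dist_norm by (simp only: norm_mult norm_of_real norm_cis add_diff_cancel_left' mult_1_right)
    then show "dist (c + of_real (r * (1 + \<delta>)) * cis x) c = r * (1 + \<delta>)" using that \<eta> r_pos by auto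
  qed
  have lt: "r * (1 + \<eta>) > r" "r * (1 + - \<eta>) < r" using \<eta> r_pos by (simp_all add: algebra_simps)
  show ?thesis
    using that[OF z(1)[of "- \<eta>"] _ z(1)[of \<eta>]] z(2)[of "- \<eta>"] z(2)[of \<eta>] lt by simp
qed

text \<open>Near the arc the winding number takes the values \<open>k\<close> and
  \<open>k + 1\<close>, while off the curve only 0 and \<open>W\<close> are possible. So whether a
  point is enclosed can be read off from its side of the circle.\<close>

lemma inside_near_arc:
  assumes \<theta>: "continuous_on UNIV \<theta>" "\<And>t. \<tau> t = cis (\<theta> t)"
    and W: "W \<in> {1, -1 :: int}" "\<And>z. z \<in> inside (range G) \<Longrightarrow> winding_number G z = of_int W"
    and x: "s < x" "x < s + \<alpha>"
  obtains e where "e > 0" "\<theta> 1 - \<theta> 0 = 2 * pi * W"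
    "\<And>z. z \<in> ball (c + of_real r * cis x) e \<Longrightarrow> z \<notin> range G \<Longrightarrow>
       z \<in> inside (range G) \<longleftrightarrow> (z \<in> ball c r \<longleftrightarrow> W = 1)"
    "\<And>z. z \<in> ball (c + of_real r * cis x) e \<Longrightarrow> z \<in> range G \<Longrightarrow> dist z c = r"
proof -
  define p where "p = c + of_real r * cis x"
  obtain k :: int and e where e: "e > 0" "\<theta> 1 - \<theta> 0 = 2 * pi * (2 * k + 1)"
    "\<And>z. z \<in> ball p e \<Longrightarrow> z \<notin> range G \<Longrightarrow>
       winding_number G z = of_int k + (if z \<in> ball c r then 1 else 0)"
    "\<And>z. z \<in> ball p e \<Longrightarrow> z \<in> range G \<Longrightarrow> dist z c = r"
    using winding_number_near_arc[OF x \<theta>] unfolding p_def by metis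
  have wn: "z \<in> inside (range G) \<and> k + (if z \<in> ball c r then 1 else 0) = W \<or>
      z \<notin> inside (range G) \<and> k + (if z \<in> ball c r then 1 else 0) = 0"
    if "z \<in> ball p e" "z \<notin> range G" for z
  proof -
    have k: "winding_number G z = of_int (k + (if z \<in> ball c r then 1 else 0))"
      using e(3)[OF that] by simp
    show ?thesis
    proof (cases "z \<in> inside (range G)")
      case True
      then have "(of_int (k + (if z \<in> ball c r then 1 else 0)) :: complex) = of_int W"
        using W(2)[OF True] k by simp
      then show ?thesis using True of_int_eq_iff by blast
    next
      case False
      then have "z \<in> outside (range G)" using that inside_Un_outside[of "range G"] by blast
      then have "of_int (k + (if z \<in> ball c r then 1 else 0)) = (0::complex)"
        using winding_number_zero_outside_range k by metis
      then show ?thesis using False of_int_eq_0_iff by blast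
    qed
  qed
  obtain z w where zw: "z \<in> ball p e" "dist z c < r" "w \<in> ball p e" "dist w c > r"
    using radial_points[OF e(1)] unfolding p_def by blast
  then have nin: "z \<notin> range G" "w \<notin> range G" using e(4)[of z] e(4)[of w] by auto
  have "z \<in> ball c r" "w \<notin> ball c r" using zw by (auto simp: dist_commute)
  then have "k + 1 = W \<or> k + 1 = 0" "k = W \<or> k = 0"
    using wn[OF zw(1) nin(1)] wn[OF zw(3) nin(2)] by auto
  \<comment> \<open>The consecutive numbers \<open>k\<close> and \<open>k + 1\<close> both lie in
    \<open>{0, W}\<close>, so \<open>k = 0\<close> for \<open>W = 1\<close> and
    \<open>k = -1\<close> for \<open>W = -1\<close>.\<close>
  then have kW: "W = 2 * k + 1" using W(1) by auto
  show ?thesis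
  proof
    show "\<theta> 1 - \<theta> 0 = 2 * pi * W" using e(2) kW by simp
    fix z assume "z \<in> ball (c + of_real r * cis x) e" "z \<notin> range G"
    then show "z \<in> inside (range G) \<longleftrightarrow> (z \<in> ball c r \<longleftrightarrow> W = 1)"
      using wn[of z] kW W(1) unfolding p_def by (auto split: if_splits)
  qed (use e p_def in auto)
qed

lemma total_turning_eq:
  assumes "continuous_on UNIV \<theta>" "\<And>t. \<tau> t = cis (\<theta> t)"
    and "W \<in> {1, -1 :: int}" "\<And>z. z \<in> inside (range G) \<Longrightarrow> winding_number G z = of_int W"
  shows "\<theta> 1 - \<theta> 0 = 2 * pi * W"
  using inside_near_arc[OF assms, of "s + \<alpha> / 2"] angle_pos by auto

lemma convex_link_iff:
  assumes W: "W \<in> {1, -1 :: int}" "\<And>z. z \<in> inside (range G) \<Longrightarrow> winding_number G z = of_int W"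
  shows "convex_link r (range G) (Link c s \<alpha>) \<longleftrightarrow> W = 1"
proof -
  obtain \<theta> where \<theta>: "continuous_on UNIV \<theta>" "\<And>t. \<tau> t = cis (\<theta> t)" using tangent_lift by metis
  show ?thesis
  proof
    assume "W = 1"
    show "convex_link r (range G) (Link c s \<alpha>)" unfolding convex_link_def
    proof
      fix p assume "p \<in> path_image (link_path r (Link c s \<alpha>)) - link_ends r (Link c s \<alpha>)"
      then obtain x where x: "s < x" "x < s + \<alpha>" and p: "p = c + of_real r * cis x"
        using part_circlepath_interior by blast
      obtain e where e: "e > 0" "\<And>z. z \<in> ball p e \<Longrightarrow> z \<notin> range G \<Longrightarrow>
         z \<in> inside (range G) \<longleftrightarrow> (z \<in> ball c r \<longleftrightarrow> W = 1)"
        using inside_near_arc[OF \<theta> W x] unfolding p by metis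
      have "inside (range G) \<inter> ball p e \<subseteq> ball c r"
      proof
        fix z assume z: "z \<in> inside (range G) \<inter> ball p e"
        then have "z \<notin> range G" using inside_no_overlap by blast
        with z e(2)[of z] \<open>W = 1\<close> show "z \<in> ball c r" by blast
      qed
      then show "\<exists>e>0. inside (range G) \<inter> ball p e \<subseteq> ball (link_centre (Link c s \<alpha>)) r"
        using e(1) by auto
    qed
  next
    assume conv: "convex_link r (range G) (Link c s \<alpha>)"
    define x p where "x = s + \<alpha> / 2" and "p = c + of_real r * cis x"
    have x: "s < x" "x < s + \<alpha>" using angle_pos by (auto simp: x_def)
    obtain e where e: "e > 0" "\<And>z. z \<in> ball p e \<Longrightarrow> z \<notin> range G \<Longrightarrow>
       z \<in> inside (range G) \<longleftrightarrow> (z \<in> ball c r \<longleftrightarrow> W = 1)"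
       "\<And>z. z \<in> ball p e \<Longrightarrow> z \<in> range G \<Longrightarrow> dist z c = r"
      using inside_near_arc[OF \<theta> W x] unfolding p_def by metis
    obtain e' where e': "e' > 0" "inside (range G) \<inter> ball p e' \<subseteq> ball c r"
      using conv arc_inner_not_end[OF x] unfolding convex_link_def p_def link.sel by blast
    have "min e e' > 0" using e(1) e'(1) by simp
    \<comment> \<open>A point outside the disc near the middle of the arc: for \<open>W = -1\<close>
      it would be enclosed, against convexity.\<close>
    then obtain w where w: "w \<in> ball p (min e e')" "dist w c > r"
      using radial_points[of "min e e'" x] unfolding p_def by blast
    then have "w \<notin> range G" "w \<notin> ball c r" "w \<in> ball p e" "w \<in> ball p e'" 
      using e(3)[of w] by (auto simp: dist_commute)
    with e(2)[of w] e'(2) show "W = 1" by blast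
  qed
qed

end

section \<open>From a smooth parametrization to chord directions\<close>

text \<open>Multiplication by \<open>cnj v\<close> rotates \<open>v\<close> to 1, so the hypothesis
  puts \<open>w\<close> in a narrow cone about \<open>v\<close>. Chords are controlled through such
  cones because these are closed under addition.\<close>

lemma norm_sgn_diff_less:
  assumes "norm v = 1" "\<bar>Im (w * cnj v)\<bar> < e * Re (w * cnj v)" "e > 0"
  shows "norm (sgn w - v) < 2 * e"
proof -
  define z where "z = w * cnj v"
  have vv: "v * cnj v = 1" using assms(1) by (simp add: complex_norm_square[symmetric])
  have nz: "norm z = norm w" using assms(1) by (simp add: z_def norm_mult)
  have Re: "0 < Re z" using assms by (smt (verit) z_def zero_less_mult_pos abs_ge_zero)
  then have "w \<noteq> 0" by (auto simp: z_def)
  have "w = z * v" unfolding z_def using vv by (simp add: mult.assoc mult.commute[of "cnj v"])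
  then have "of_real (norm w) * (sgn w - v) = (z - of_real (norm z)) * v"
    using \<open>w \<noteq> 0\<close> nz by (simp add: sgn_eq algebra_simps)
  then have "norm w * norm (sgn w - v) = norm (z - of_real (norm z))"
    using assms(1) by (metis norm_mult norm_of_real abs_norm_cancel mult.right_neutral)
  also have "\<dots> \<le> \<bar>Re (z - of_real (norm z))\<bar> + \<bar>Im (z - of_real (norm z))\<bar>" by (rule cmod_le)
  also have "\<dots> = (norm z - Re z) + \<bar>Im z\<bar>" using complex_Re_le_cmod[of z] by simp
  also have "\<dots> \<le> 2 * \<bar>Im z\<bar>" using cmod_le[of z] Re by simp
  also have "\<dots> < 2 * (e * Re z)" using assms(2) by (simp add: z_def)
  also have "\<dots> \<le> 2 * (e * norm z)" using assms(3) complex_Re_le_cmod[of z] by simp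
  finally have "norm w * norm (sgn w - v) < norm w * (2 * e)" using nz by (simp add: mult_ac)
  then show ?thesis using \<open>w \<noteq> 0\<close> by simp
qed

text \<open>The cone is cut out by the two real-linear forms \<open>F 1\<close> and
  \<open>F (-1)\<close>. Near \<open>t\<close> each is positive on \<open>g'\<close> by continuity,
  so each increases along \<open>g\<close>; the claim is thus reduced to real functions.\<close>

lemma chord_in_cone:
  fixes g :: "real \<Rightarrow> complex"
  assumes deriv: "\<And>t. t \<in> {a..b} \<Longrightarrow> (g has_vector_derivative g' t) (at t within {a..b})"
    and cont: "continuous_on {a..b} g'" and t: "t \<in> {a..b}" "g' t \<noteq> 0" and e: "e > 0"
  shows "\<exists>d>0. \<forall>s u. s \<in> {a..b} \<and> u \<in> {a..b} \<and> s < u \<and> \<bar>s - t\<bar> < d \<and> \<bar>u - t\<bar> < d \<longrightarrow>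
     \<bar>Im ((g u - g s) * cnj (sgn (g' t)))\<bar> < e * Re ((g u - g s) * cnj (sgn (g' t)))"
proof -
  define v where "v = sgn (g' t)"
  define F where "F \<sigma> z = e * Re (z * cnj v) + \<sigma> * Im (z * cnj v)" for \<sigma> z
  have lin: "bounded_linear (F \<sigma>)" for \<sigma>
    unfolding F_def
    by (intro bounded_linear_add bounded_linear_const_mult bounded_linear_compose[OF bounded_linear_Re]
        bounded_linear_compose[OF bounded_linear_Im] bounded_linear_mult_left)
  have piece: "\<exists>d>0. \<forall>s u. s \<in> {a..b} \<and> u \<in> {a..b} \<and> s < u \<and> \<bar>s - t\<bar> < d \<and> \<bar>u - t\<bar> < d \<longrightarrow> F \<sigma> (g s) < F \<sigma> (g u)" for \<sigma>
  proof -
    have "g' t * cnj v = of_real (norm (g' t))"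
      using t(2) by (simp add: v_def sgn_eq complex_norm_square[symmetric] power2_eq_square)
    then have pos: "F \<sigma> (g' t) > 0" using t(2) e by (simp add: F_def)
    have "continuous_on {a..b} (\<lambda>u. F \<sigma> (g' u))"
      using bounded_linear.continuous_on[OF lin cont] by simp
    then obtain d where d: "d > 0" "\<And>u. u \<in> {a..b} \<Longrightarrow> dist u t < d \<Longrightarrow> dist (F \<sigma> (g' u)) (F \<sigma> (g' t)) < F \<sigma> (g' t)"
      using t(1) pos unfolding continuous_on_iff by blast
    have "F \<sigma> (g s) < F \<sigma> (g u)" if su: "s \<in> {a..b}" "u \<in> {a..b}" "s < u" "\<bar>s - t\<bar> < d" "\<bar>u - t\<bar> < d" for s u
    proof (rule DERIV_pos_imp_increasing_open[OF su(3)])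
      fix x assume x: "s < x" "x < u"
      then have xi: "x \<in> interior {a..b}" "x \<in> {a..b}" using su by auto
      have "((\<lambda>x. F \<sigma> (g x)) has_vector_derivative F \<sigma> (g' x)) (at x within {a..b})"
        by (rule bounded_linear.has_vector_derivative[OF lin deriv[OF xi(2)]])
      then have "DERIV (\<lambda>x. F \<sigma> (g x)) x :> F \<sigma> (g' x)"
        using at_within_interior[OF xi(1)] by (simp add: has_real_derivative_iff_has_vector_derivative)
      moreover have "dist x t < d" using x su by (auto simp: dist_real_def)
      then have "F \<sigma> (g' x) > 0" using d(2)[OF xi(2)] by (auto simp: dist_real_def)
      ultimately show "\<exists>y. DERIV (\<lambda>x. F \<sigma> (g x)) x :> y \<and> 0 < y" by blast
    next
      have "continuous_on {a..b} g" using deriv by (rule continuous_on_vector_derivative)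
      then show "continuous_on {s..u} (\<lambda>x. F \<sigma> (g x))"
        using su by (intro bounded_linear.continuous_on[OF lin]) (auto elim: continuous_on_subset)
    qed
    then show ?thesis using d(1) by blast
  qed
  obtain d1 d2 where d: "d1 > 0" "d2 > 0"
    "\<And>s u. s \<in> {a..b} \<and> u \<in> {a..b} \<and> s < u \<and> \<bar>s - t\<bar> < d1 \<and> \<bar>u - t\<bar> < d1 \<Longrightarrow> F 1 (g s) < F 1 (g u)"
    "\<And>s u. s \<in> {a..b} \<and> u \<in> {a..b} \<and> s < u \<and> \<bar>s - t\<bar> < d2 \<and> \<bar>u - t\<bar> < d2 \<Longrightarrow> F (-1) (g s) < F (-1) (g u)"
    using piece[of 1] piece[of "-1"] by metis
  have "\<bar>Im ((g u - g s) * cnj v)\<bar> < e * Re ((g u - g s) * cnj v)"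
    if "s \<in> {a..b} \<and> u \<in> {a..b} \<and> s < u \<and> \<bar>s - t\<bar> < min d1 d2 \<and> \<bar>u - t\<bar> < min d1 d2" for s u
  proof -
    have "F 1 (g u - g s) > 0" "F (-1) (g u - g s) > 0"
      using d(3,4)[of s u] that by (simp_all add: linear_diff[OF bounded_linear.linear[OF lin]])
    then show ?thesis by (simp add: F_def del: times_complex.sel)
  qed
  then show ?thesis using d(1,2) unfolding v_def by (intro exI[of _ "min d1 d2"]) auto
qed

lemma tangent_loop_of_smooth_curve:
  assumes "smooth_simple_closed_curve T"
  obtains G \<tau> where "tangent_loop G \<tau>" "range G = T"
proof -
  obtain g g' where g: "simple_path g" "pathfinish g = pathstart g" "path_image g = T"
    and deriv: "\<And>t. t \<in> {0..1} \<Longrightarrow> (g has_vector_derivative g' t) (at t within {0..1})"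
    and nz: "\<And>t. t \<in> {0..1} \<Longrightarrow> g' t \<noteq> 0"
    and cont: "continuous_on {0..1} g'" and tan: "sgn (g' 0) = sgn (g' 1)"
    using assms unfolding smooth_simple_closed_curve_def by blast
  define G where "G t = g (frac t)" for t
  define \<tau> where "\<tau> t = sgn (g' (frac t))" for t
  have g01: "g 1 = g 0" using g(2) by (simp add: pathfinish_def pathstart_def)
  \<comment> \<open>Since \<open>g 1 = g 0\<close>, the formula also holds at the right end of a
    period, where \<open>frac\<close> has jumped back to 0.\<close>
  have G: "G t = g (t - of_int m)" if "of_int m \<le> t" "t \<le> of_int m + 1" for m t
  proof (cases "t = of_int m + 1")
    case True
    then show ?thesis using g01 by (simp add: G_def)
  next
    case False
    then have "\<lfloor>t\<rfloor> = m" using that by (intro floor_unique) auto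
    then show ?thesis by (simp add: G_def frac_def)
  qed
  have T: "\<tau> t = sgn (g' (t - of_int m))" if "of_int m \<le> t" "t \<le> of_int m + 1" for m t
  proof (cases "t = of_int m + 1")
    case True
    then show ?thesis using tan by (simp add: \<tau>_def)
  next
    case False
    then have "\<lfloor>t\<rfloor> = m" using that by (intro floor_unique) auto
    then show ?thesis by (simp add: \<tau>_def frac_def)
  qed
  have frac: "frac t \<in> {0..1}" "frac t < 1" for t :: real using frac_lt_1[of t] by (auto simp: order_less_imp_le)
  have cone: "\<exists>d>0. \<forall>s u. of_int m \<le> s \<and> u \<le> of_int m + 1 \<and> s < u \<and> \<bar>s - t\<bar> < d \<and> \<bar>u - t\<bar> < d \<longrightarrow>
     \<bar>Im ((G u - G s) * cnj (\<tau> t))\<bar> < e * Re ((G u - G s) * cnj (\<tau> t))"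
    if tme: "of_int m \<le> t" "t \<le> of_int m + 1" "e > 0" for m t e
  proof -
    have tm: "t - of_int m \<in> {0..1}" using tme by auto
    obtain d where d: "d > 0" "\<And>s u. s \<in> {0..1} \<Longrightarrow> u \<in> {0..1} \<Longrightarrow> s < u \<Longrightarrow> \<bar>s - (t - of_int m)\<bar> < d \<Longrightarrow>
       \<bar>u - (t - of_int m)\<bar> < d \<Longrightarrow>
       \<bar>Im ((g u - g s) * cnj (sgn (g' (t - of_int m))))\<bar> < e * Re ((g u - g s) * cnj (sgn (g' (t - of_int m))))"
      using chord_in_cone[OF deriv cont tm nz[OF tm] tme(3)] by blast
    have "\<bar>Im ((G u - G s) * cnj (\<tau> t))\<bar> < e * Re ((G u - G s) * cnj (\<tau> t))"
      if "of_int m \<le> s \<and> u \<le> of_int m + 1 \<and> s < u \<and> \<bar>s - t\<bar> < d \<and> \<bar>u - t\<bar> < d" for s u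
    proof -
      have "G u = g (u - of_int m)" "G s = g (s - of_int m)" using that by (auto intro!: G)
      then show ?thesis unfolding T[OF tme(1,2)]
        using d(2)[of "s - of_int m" "u - of_int m"] that by simp
    qed
    then show ?thesis using d(1) by blast
  qed
  have "tangent_loop G \<tau>"
  proof
    have piece: "continuous_on {of_int m..of_int m + 1} G" for m
    proof (rule continuous_on_eq)
      show "continuous_on {of_int m..of_int m + 1} (\<lambda>t. g (t - of_int m))"
        using simple_path_imp_path[OF g(1)] unfolding path_def
        by (rule continuous_on_compose2) (auto intro!: continuous_intros)
    qed (use G in auto)
    have "isCont G t" for t
    proof -
      define m where "m = \<lfloor>t\<rfloor>"
      have "continuous_on ({of_int (m - 1)..of_int (m - 1) + 1} \<union> {of_int m..of_int m + 1}) G"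
        by (intro continuous_on_closed_Un piece closed_atLeastAtMost)
      then have "continuous_on {of_int m - 1<..<of_int m + 1} G"
        by (rule continuous_on_subset) auto
      moreover have "t \<in> {of_int m - 1<..<of_int m + 1}" unfolding m_def greaterThanLessThan_iff by linarith
      ultimately show ?thesis by (simp add: continuous_on_eq_continuous_at)
    qed
    then show "continuous_on UNIV G" by (simp add: continuous_at_imp_continuous_on)
    show "G s = G t \<longleftrightarrow> t - s \<in> \<int>" for s t
    proof -
      have "G s = G t \<longleftrightarrow> frac s = frac t"
        using g(1) frac[of s] frac[of t] unfolding G_def simple_path_def loop_free_def by fastforce
      also have "\<dots> \<longleftrightarrow> t - s \<in> \<int>"
      proof
        assume "frac s = frac t"
        then have "t - s = of_int (\<lfloor>t\<rfloor> - \<lfloor>s\<rfloor>)" by (simp add: frac_def)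
        then show "t - s \<in> \<int>" by (metis Ints_of_int)
      next
        assume "t - s \<in> \<int>"
        then obtain k where "t = s + of_int k" by (metis Ints_cases add.commute diff_add_cancel)
        then show "frac s = frac t" by (simp add: frac_def)
      qed
      finally show ?thesis .
    qed
    show "norm (\<tau> t) = 1" for t using nz[OF frac(1)] by (simp add: \<tau>_def norm_sgn)
    show "\<tau> (t + 1) = \<tau> t" for t by (simp add: \<tau>_def frac_def)
    then have norm: "norm (\<tau> t) = 1" for t using nz[OF frac(1)] by (simp add: \<tau>_def norm_sgn)
    fix e t :: real assume e: "e > 0"
    define m where "m = \<lfloor>t\<rfloor>"
    have m: "of_int m \<le> t" "t < of_int m + 1" unfolding m_def by linarith+
    have "\<exists>d>0. \<forall>s u. t - d < s \<and> s < u \<and> u < t + d \<longrightarrow>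
       \<bar>Im ((G u - G s) * cnj (\<tau> t))\<bar> < (e / 2) * Re ((G u - G s) * cnj (\<tau> t))"
    proof (cases "t = of_int m")
      case False
      obtain d where d: "d > 0" "\<And>s u. of_int m \<le> s \<and> u \<le> of_int m + 1 \<and> s < u \<and> \<bar>s - t\<bar> < d \<and> \<bar>u - t\<bar> < d \<Longrightarrow>
         \<bar>Im ((G u - G s) * cnj (\<tau> t))\<bar> < (e / 2) * Re ((G u - G s) * cnj (\<tau> t))"
        using cone[of m t "e / 2"] m e by (metis half_gt_zero order_less_imp_le)
      define d' where "d' = min d (min (t - of_int m) (of_int m + 1 - t))"
      have "d' > 0" using d(1) m False by (auto simp: d'_def)
      moreover have "\<bar>Im ((G u - G s) * cnj (\<tau> t))\<bar> < (e / 2) * Re ((G u - G s) * cnj (\<tau> t))"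
        if "t - d' < s \<and> s < u \<and> u < t + d'" for s u
        using that by (intro d(2)) (auto simp: d'_def)
      ultimately show ?thesis by blast
    next
      \<comment> \<open>At an integer the two sides belong to different periods. A chord passing
        over \<open>t\<close> is the sum of a chord ending at \<open>t\<close> and one starting
        there; the equal tangent directions at 0 and 1 put both into the same cone.\<close>
      case True
      obtain d1 where d1: "d1 > 0" "\<And>s u. of_int m \<le> s \<and> u \<le> of_int m + 1 \<and> s < u \<and> \<bar>s - t\<bar> < d1 \<and> \<bar>u - t\<bar> < d1 \<Longrightarrow>
         \<bar>Im ((G u - G s) * cnj (\<tau> t))\<bar> < (e / 2) * Re ((G u - G s) * cnj (\<tau> t))"
        using cone[of m t "e / 2"] m e by (metis half_gt_zero order_less_imp_le)
      obtain d2 where d2: "d2 > 0" "\<And>s u. of_int (m - 1) \<le> s \<and> u \<le> of_int (m - 1) + 1 \<and> s < u \<and> \<bar>s - t\<bar> < d2 \<and> \<bar>u - t\<bar> < d2 \<Longrightarrow>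
         \<bar>Im ((G u - G s) * cnj (\<tau> t))\<bar> < (e / 2) * Re ((G u - G s) * cnj (\<tau> t))"
        using cone[of "m - 1" t "e / 2"] m e True by auto
      have "\<bar>Im ((G u - G s) * cnj (\<tau> t))\<bar> < (e / 2) * Re ((G u - G s) * cnj (\<tau> t))"
        if su: "t - min 1 (min d1 d2) < s \<and> s < u \<and> u < t + min 1 (min d1 d2)" for s u
      proof -
        consider "u \<le> t" | "t \<le> s" | "s < t" "t < u" by linarith
        then show ?thesis
        proof cases
          case 1
          then show ?thesis using su True by (intro d2) (auto simp: min_def split: if_splits)
        next
          case 2
          then show ?thesis using su True by (intro d1) (auto simp: min_def split: if_splits)
        next
          case 3
          have "\<bar>Im ((G t - G s) * cnj (\<tau> t))\<bar> < (e / 2) * Re ((G t - G s) * cnj (\<tau> t))"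
            using su True 3 by (intro d2) (auto simp: min_def split: if_splits)
          moreover have "\<bar>Im ((G u - G t) * cnj (\<tau> t))\<bar> < (e / 2) * Re ((G u - G t) * cnj (\<tau> t))"
            using su True 3 by (intro d1) (auto simp: min_def split: if_splits)
          moreover have eq: "(G u - G s) * cnj (\<tau> t) = (G t - G s) * cnj (\<tau> t) + (G u - G t) * cnj (\<tau> t)"
            by (simp add: algebra_simps)
          ultimately show ?thesis unfolding eq plus_complex.sel distrib_left by linarith
        qed
      qed
      moreover have "min 1 (min d1 d2) > 0" using d1(1) d2(1) by simp
      ultimately show ?thesis by blast
    qed
    then show "\<exists>d>0. \<forall>s u. t - d < s \<and> s < u \<and> u < t + d \<longrightarrow> norm (sgn (G u - G s) - \<tau> t) < e"
      using norm_sgn_diff_less[OF norm, of _ t "e / 2"] e by fastforce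
  qed
  moreover have "range G = T"
  proof -
    have "g x \<in> range G" if "x \<in> {0..1}" for x
      using G[of 0 x] that by (metis atLeastAtMost_iff add_0 diff_zero of_int_0 rangeI)
    then have "g ` {0..1} \<subseteq> range G" by blast
    moreover have "range G \<subseteq> g ` {0..1}" using frac(1) by (auto simp: G_def)
    ultimately show ?thesis using g(3) by (auto simp: path_image_def)
  qed
  ultimately show ?thesis using that by blast
qed

section \<open>Parametrizing a link by the parameter of the curve\<close>

lemma arc_inj:
  assumes "r > 0" "c + of_real r * cis x = c + of_real r * cis y" "x < y"
  shows "x + 2 * pi \<le> y"
proof (rule ccontr)
  assume "\<not> ?thesis"
  then have "sgn ((c + of_real r * cis y) - (c + of_real r * cis x)) = cis ((x + y) / 2 + pi / 2)"
    using assms by (intro sgn_chord) auto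
  then show False unfolding assms(2) by simp
qed

context tangent_loop
begin

text \<open>\<open>H\<close> inverts the curve, with the parameter modulo 1 seen as a point of the
  unit circle. It is continuous because \<open>G\<close> maps the compact unit interval onto the
  curve, so that preimages of closed sets are images of compact sets.\<close>

lemma circle_coordinate:
  obtains H where "continuous_on (range G) H" "\<And>t. H (G t) = cis (2 * pi * t)"
proof -
  define H where "H z = cis (2 * pi * (SOME t. G t = z))" for z
  have H: "H (G t) = cis (2 * pi * t)" for t
  proof -
    define u where "u = (SOME u. G u = G t)"
    have "G u = G t" unfolding u_def by (rule someI) simp
    then have "t - u \<in> \<int>" by (simp add: G_eq_iff)
    then have "cis (2 * pi * (t - u)) = 1" by (rule cis_multiple_2pi)
    then have "cis (2 * pi * t) = cis (2 * pi * u)" by (simp add: right_diff_distrib cis_divide[symmetric])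
    then show ?thesis by (simp add: H_def u_def)
  qed
  have c: "continuous_on S (\<lambda>t::real. cis (2 * pi * t))" for S
    by (intro continuous_on_cis continuous_intros)
  have "range G = G ` {0..1}" using range_G_eq[of 0] by simp
  moreover have "compact (G ` {0..1})"
    using continuous_G continuous_on_subset by (intro compact_continuous_image) blast+
  ultimately have closed: "closed (range G)" by (simp add: compact_imp_closed)
  have "closed (H -` B \<inter> range G)" if "closed B" for B
  proof -
    have "H -` B \<inter> range G = G ` ((\<lambda>t. cis (2 * pi * t)) -` B \<inter> {0..1})"
      unfolding \<open>range G = G ` {0..1}\<close> using H by auto
    moreover have "closed ((\<lambda>t::real. cis (2 * pi * t)) -` B \<inter> {0..1})"
      using continuous_on_closed_vimage[of "{0..1::real}"] c that by blast
    then have "compact ((\<lambda>t::real. cis (2 * pi * t)) -` B \<inter> {0..1})"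
      by (metis compact_Int_closed compact_Icc inf_commute inf.right_idem)
    then have "compact (G ` ((\<lambda>t. cis (2 * pi * t)) -` B \<inter> {0..1}))"
      using continuous_G continuous_on_subset by (intro compact_continuous_image) blast+
    ultimately show ?thesis by (simp add: compact_imp_closed)
  qed
  then have "continuous_on (range G) H"
    using continuous_on_closed_vimage[OF closed] by blast
  then show ?thesis using that H by blast
qed

text \<open>Along the arc, \<open>H\<close> has a continuous angle, which divided by
  \<open>2 * pi\<close> is the curve parameter. Equal parameters mean equal points, and on an arc of
  at most one turn these occur only at the two ends of a full circle.\<close>

lemma arc_parameter:
  assumes "r > 0" "0 < \<alpha>" "\<alpha> \<le> 2 * pi" "\<And>x. x \<in> {s..s + \<alpha>} \<Longrightarrow> c + of_real r * cis x \<in> range G"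
  obtains \<psi> where "continuous_on {s..s + \<alpha>} \<psi>" 
    "\<And>x. x \<in> {s..s + \<alpha>} \<Longrightarrow> G (\<psi> x) = c + of_real r * cis x" "inj_on \<psi> {s..s + \<alpha>}"
proof -
  obtain H where H: "continuous_on (range G) H" "\<And>t. H (G t) = cis (2 * pi * t)"
    using circle_coordinate by metis
  have "continuous_on {s..s + \<alpha>} (\<lambda>x. H (c + of_real r * cis x))"
    by (rule continuous_on_compose2[OF H(1)])
      (use assms(4) in \<open>auto intro!: continuous_intros continuous_on_cis\<close>)
  moreover have "norm (H (c + of_real r * cis x)) = 1" if "x \<in> {s..s + \<alpha>}" for x
    using assms(4)[OF that] H(2) by force
  moreover have "convex {s..s + \<alpha>}" by simp
  ultimately obtain f where f: "continuous_on {s..s + \<alpha>} f"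
    "\<And>x. x \<in> {s..s + \<alpha>} \<Longrightarrow> H (c + of_real r * cis x) = cis (f x)"
    using cis_lift_exists[of "{s..s + \<alpha>}" "\<lambda>x. H (c + of_real r * cis x)"] by blast
  define \<psi> where "\<psi> x = f x / (2 * pi)" for x
  have cont: "continuous_on {s..s + \<alpha>} \<psi>" unfolding \<psi>_def by (intro continuous_intros f) auto
  have G: "G (\<psi> x) = c + of_real r * cis x" if x: "x \<in> {s..s + \<alpha>}" for x
  proof -
    obtain t where t: "c + of_real r * cis x = G t" using assms(4)[OF x] by auto
    have "cis (2 * pi * t) = cis (2 * pi * \<psi> x)"
      using f(2)[OF x] H(2)[of t] t by (simp add: \<psi>_def)
    then have "cis (2 * pi * (t - \<psi> x)) = 1" by (simp add: right_diff_distrib cis_divide[symmetric])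
    then have "cos (2 * pi * (t - \<psi> x)) = 1" by (metis cis.simps(1) one_complex.simps(1))
    then obtain n :: int where "2 * pi * (t - \<psi> x) = of_int n * 2 * pi" using cos_one_2pi_int by blast
    then have "t - \<psi> x = of_int n" by simp
    then have "G (\<psi> x) = G t" unfolding G_eq_iff by simp
    then show ?thesis using t by simp
  qed
  have half: "x + 2 * pi \<le> y" if "x \<in> {s..s + \<alpha>}" "y \<in> {s..s + \<alpha>}" "\<psi> x = \<psi> y" "x < y" for x y
    using arc_inj[of r c x y] G[OF that(1)] G[OF that(2)] that assms(1) by simp
  have no: False if x: "x \<in> {s..s + \<alpha>}" "y \<in> {s..s + \<alpha>}" "\<psi> x = \<psi> y" "x < y" for x y
  proof -
    have xy: "x = s" "y = s + \<alpha>" "\<alpha> = 2 * pi" using half[OF x] x assms(3) by auto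
    \<comment> \<open>What remains is a full circle with
      \<open>\<psi> s = \<psi> (s + \<alpha>)\<close>. Then \<open>\<psi>\<close> takes the value
      \<open>v\<close>, halfway between its values at the ends and at the middle angle
      \<open>m\<close>, on both halves of the arc, at two angles less than a full turn
      apart.\<close>
    define m where "m = s + pi"
    define v where "v = (\<psi> s + \<psi> m) / 2"
    have m: "s < m" "m < s + \<alpha>" "m \<in> {s..s + \<alpha>}" unfolding m_def xy(3) using pi_gt_zero by auto
    have "\<psi> s \<noteq> \<psi> m"
    proof
      assume "\<psi> s = \<psi> m"
      then have "s + 2 * pi \<le> m" using half[of s m] m assms(2) by simp
      then show False using pi_gt_zero by (simp add: m_def)
    qed
    then have ne: "v \<noteq> \<psi> s" "v \<noteq> \<psi> m" "v \<in> closed_segment (\<psi> s) (\<psi> m)" "v \<in> closed_segment (\<psi> m) (\<psi> (s + \<alpha>))"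
      using x(3) unfolding xy(1,2) by (auto simp: v_def closed_segment_eq_real_ivl)
    have "connected (\<psi> ` {s..m})" "connected (\<psi> ` {m..s + \<alpha>})"
      using cont m by (auto intro!: connected_continuous_image elim: continuous_on_subset)
    then have "closed_segment (\<psi> s) (\<psi> m) \<subseteq> \<psi> ` {s..m}" 
      "closed_segment (\<psi> m) (\<psi> (s + \<alpha>)) \<subseteq> \<psi> ` {m..s + \<alpha>}"
      using m by (simp_all add: connected_convex_1 closed_segment_subset)
    then have "v \<in> \<psi> ` {s..m}" "v \<in> \<psi> ` {m..s + \<alpha>}" using ne(3,4) by (simp_all add: subset_iff)
    then obtain y1 y2 where y: "y1 \<in> {s..m}" "y2 \<in> {m..s + \<alpha>}" "\<psi> y1 = v" "\<psi> y2 = v"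
      by (elim imageE) metis
    then have "y1 \<noteq> s" "y1 \<noteq> m" "y2 \<noteq> m" using ne by auto
    then have "y1 < y2" "y2 < y1 + 2 * pi" using y xy(3) by auto
    then show False using half[of y1 y2] y m by auto
  qed
  have "inj_on \<psi> {s..s + \<alpha>}"
    by (rule inj_onI) (metis no linorder_less_linear)
  then show ?thesis using that cont G by blast
qed

text \<open>Otherwise \<open>\<psi>\<close> would reach \<open>\<psi> s + 1\<close> before the end
  of the arc, bringing the curve back to its start after less than a full turn of the
  circle.\<close>

lemma arc_parameter_le:
  assumes "r > 0" "0 < \<alpha>" "\<alpha> \<le> 2 * pi" "continuous_on {s..s + \<alpha>} \<psi>"
    "\<And>x. x \<in> {s..s + \<alpha>} \<Longrightarrow> G (\<psi> x) = c + of_real r * cis x"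
  shows "\<psi> (s + \<alpha>) \<le> \<psi> s + 1"
proof (rule ccontr)
  assume gt: "\<not> ?thesis"
  then obtain x where x: "s \<le> x" "x \<le> s + \<alpha>" "\<psi> x = \<psi> s + 1"
    using IVT'[of \<psi> s "\<psi> s + 1" "s + \<alpha>"] assms(2,4) by auto
  then have "x \<noteq> s" "x \<noteq> s + \<alpha>" using gt by auto
  moreover have "c + of_real r * cis s = c + of_real r * cis x"
    using assms(5)[of s] assms(5)[of x] x assms(2) by simp
  ultimately show False using arc_inj[of r c s x] x assms(1,3) by auto
qed

text \<open>A continuous injective function on an interval is monotone; a decreasing
  \<open>\<psi>\<close> becomes increasing by negation, on the reversed curve.\<close>

lemma arc_cases:
  assumes "r > 0" "0 < \<alpha>" "\<alpha> \<le> 2 * pi" "\<And>x. x \<in> {s..s + \<alpha>} \<Longrightarrow> c + of_real r * cis x \<in> range G"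
  obtains \<psi> where "loop_arc G \<tau> c r s \<alpha> \<psi>"
    | \<psi> where "loop_arc (\<lambda>t. G (- t)) (\<lambda>t. - \<tau> (- t)) c r s \<alpha> \<psi>"
proof -
  obtain \<psi> where \<psi>: "continuous_on {s..s + \<alpha>} \<psi>" 
    "\<And>x. x \<in> {s..s + \<alpha>} \<Longrightarrow> G (\<psi> x) = c + of_real r * cis x" "inj_on \<psi> {s..s + \<alpha>}"
    using arc_parameter[OF assms] by metis
  then have "strict_mono_on {s..s + \<alpha>} \<psi> \<or> strict_antimono_on {s..s + \<alpha>} \<psi>"
    using injective_eq_monotone_map[of "{s..s + \<alpha>}" \<psi>] is_interval_cc by blast
  then show ?thesis
  proof
    assume "strict_mono_on {s..s + \<alpha>} \<psi>"
    then have "loop_arc G \<tau> c r s \<alpha> \<psi>"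
      using \<psi> assms arc_parameter_le[OF assms(1-3) \<psi>(1,2)] tangent_loop_axioms
      by (simp add: loop_arc_def loop_arc_axioms_def)
    then show ?thesis by (rule that(1))
  next
    assume anti: "strict_antimono_on {s..s + \<alpha>} \<psi>"
    interpret rev: tangent_loop "\<lambda>t. G (- t)" "\<lambda>t. - \<tau> (- t)" by (rule reverse)
    have "strict_mono_on {s..s + \<alpha>} (\<lambda>x. - \<psi> x)"
      using anti by (auto simp: monotone_on_def)
    moreover have c: "continuous_on {s..s + \<alpha>} (\<lambda>x. - \<psi> x)" by (intro continuous_intros \<psi>)
    moreover have "- \<psi> (s + \<alpha>) \<le> - \<psi> s + 1"
      using rev.arc_parameter_le[OF assms(1-3) c, of c] \<psi>(2) by simp
    ultimately have "loop_arc (\<lambda>t. G (- t)) (\<lambda>t. - \<tau> (- t)) c r s \<alpha> (\<lambda>x. - \<psi> x)"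
      using \<psi>(2) assms rev.tangent_loop_axioms
      by (simp add: loop_arc_def loop_arc_axioms_def)
    then show ?thesis by (rule that(2))
  qed
qed

end

section \<open>Tiling a period by links\<close>

text \<open>Tagged by their left ends, the intervals form a tagged division of
  \<open>{A..B}\<close>, so the sum telescopes without an ordering of \<open>L\<close>.\<close>

lemma sum_tiling:
  fixes f a b :: "_ \<Rightarrow> real"
  assumes "finite L" "A \<le> B" "\<And>l. l \<in> L \<Longrightarrow> a l < b l" "\<And>l. l \<in> L \<Longrightarrow> {a l..b l} \<subseteq> {A..B}"
    and disj: "\<And>l k. l \<in> L \<Longrightarrow> k \<in> L \<Longrightarrow> l \<noteq> k \<Longrightarrow> {a l<..<b l} \<inter> {a k<..<b k} = {}"
    and "{A..B} \<subseteq> (\<Union>l\<in>L. {a l..b l})"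
  shows "(\<Sum>l\<in>L. f (b l) - f (a l)) = f B - f A"
proof -
  define h where "h l = (a l, {a l..b l})" for l
  have inj: "inj_on h L"
  proof (rule inj_onI, rule ccontr)
    fix l k assume lk: "l \<in> L" "k \<in> L" "h l = h k" "l \<noteq> k"
    then have "a l = a k" "{a l..b l} = {a k..b k}" by (auto simp: h_def)
    then have "{a l<..<b l} = {a k<..<b k}" by (metis interior_atLeastAtMost_real)
    moreover have "(a l + b l) / 2 \<in> {a l<..<b l}" using assms(3)[OF lk(1)] by auto
    ultimately show False using disj[OF lk(1,2,4)] by blast
  qed
  have "h ` L tagged_division_of {A..B}"
  proof (rule tagged_division_ofI)
    show "finite (h ` L)" using assms(1) by simp
    show "x \<in> K" "K \<subseteq> {A..B}" "\<exists>u v. K = cbox u v" if "(x, K) \<in> h ` L" for x K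
      using that assms(3,4) by (force simp: h_def)+
    show "interior K1 \<inter> interior K2 = {}"
      if h: "(x1, K1) \<in> h ` L" "(x2, K2) \<in> h ` L" "(x1, K1) \<noteq> (x2, K2)" for x1 K1 x2 K2
    proof -
      obtain l where l: "l \<in> L" "(x1, K1) = h l" using h(1) by auto
      obtain k where k: "k \<in> L" "(x2, K2) = h k" using h(2) by auto
      have "l \<noteq> k" using h(3) l k by auto
      from disj[OF l(1) k(1) this] show ?thesis using l(2) k(2) by (simp add: h_def)
    qed
    have "\<Union> {K. \<exists>x. (x, K) \<in> h ` L} = (\<Union>l\<in>L. {a l..b l})" by (auto simp: h_def)
    also have "\<dots> = {A..B}" using assms(4,6) by (intro equalityI UN_least)
    finally show "\<Union> {K. \<exists>x. (x, K) \<in> h ` L} = {A..B}" .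
  qed
  from additive_tagged_division_1[OF assms(2) this, of f]
  have "f B - f A = (\<Sum>(x, K)\<in>h ` L. f (Sup K) - f (Inf K))" by simp
  also have "\<dots> = (\<Sum>l\<in>L. f (b l) - f (a l))"
    unfolding sum.reindex[OF inj] using assms(3) by (intro sum.cong) (auto simp: h_def less_imp_le)
  finally show ?thesis by simp
qed

context loop_arc
begin

lemma psi_image: "\<psi> ` {s..s + \<alpha>} = {\<psi> s..\<psi> (s + \<alpha>)}"
proof
  show "\<psi> ` {s..s + \<alpha>} \<subseteq> {\<psi> s..\<psi> (s + \<alpha>)}" using psi_leq angle_pos by auto
  show "{\<psi> s..\<psi> (s + \<alpha>)} \<subseteq> \<psi> ` {s..s + \<alpha>}"
    using IVT'[of \<psi> s _ "s + \<alpha>"] angle_pos continuous_psi by fastforce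
qed

lemma G_image: "G ` {\<psi> s..\<psi> (s + \<alpha>)} = path_image (link_path r (Link c s \<alpha>))"
proof -
  have "G ` {\<psi> s..\<psi> (s + \<alpha>)} = (\<lambda>x. c + of_real r * cis x) ` {s..s + \<alpha>}"
    unfolding psi_image[symmetric] image_image using G_psi by (intro image_cong) auto
  then show ?thesis
    using angle_pos by (simp add: link_path_def path_image_subpath flip: subpath_eq_part_circlepath)
qed

lemma G_inner_not_end:
  assumes "t \<in> {\<psi> s<..<\<psi> (s + \<alpha>)}"
  shows "G t \<notin> link_ends r (Link c s \<alpha>)"
proof -
  have "t \<in> \<psi> ` {s..s + \<alpha>}" unfolding psi_image using assms by auto
  then obtain x where x: "x \<in> {s..s + \<alpha>}" "t = \<psi> x" by auto
  with assms have "x \<noteq> s" "x \<noteq> s + \<alpha>" by auto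
  then show ?thesis using x G_psi[OF x(1)] arc_inner_not_end[of x] by simp
qed

end

context tangent_loop
begin

lemma winding_number_reverse:
  assumes "z \<notin> range G"
  shows "winding_number (\<lambda>t. G (- t)) z = - winding_number G z"
proof -
  have "reversepath G t = G (- t)" for t
    using G_add_1[of "- t"] by (simp add: reversepath_def)
  then have "(\<lambda>t. G (- t)) = reversepath G" by auto
  then show ?thesis
    using winding_number_reversepath[of G z] simple_path_imp_path[OF simple_path_G(1)] assms path_image_G by simp
qed

lemma range_reverse: "range (\<lambda>t. G (- t)) = range G"
proof -
  have "G t \<in> range (\<lambda>t. G (- t))" for t using rangeI[of "\<lambda>t. G (- t)" "- t"] by simp
  then show ?thesis by auto
qed

text \<open>A parameter interval on which the curve traces the link. The condition on
  \<open>link_ends\<close> keeps the open intervals of different links apart. The sign of the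
  turning is expressed by convexity and \<open>W\<close>, so that the direction of traversal no
  longer appears.\<close>

definition link_interval :: "real \<Rightarrow> (real \<Rightarrow> real) \<Rightarrow> int \<Rightarrow> link \<Rightarrow> real \<Rightarrow> real \<Rightarrow> bool" where
  "link_interval r \<theta> W l a b \<longleftrightarrow> a < b \<and> b \<le> a + 1 \<and> G ` {a..b} = path_image (link_path r l) \<and>
     (\<forall>t\<in>{a<..<b}. G t \<notin> link_ends r l) \<and>
     \<theta> b - \<theta> a = (if convex_link r (range G) l then 1 else (- 1 :: real)) * W * link_angle l"

lemma link_interval_exists:
  assumes "r > 0" "0 < link_angle l" "link_angle l \<le> 2 * pi" "path_image (link_path r l) \<subseteq> range G"
    and \<theta>: "continuous_on UNIV \<theta>" "\<And>t. \<tau> t = cis (\<theta> t)"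
    and W: "W \<in> {1, -1 :: int}" "\<And>z. z \<in> inside (range G) \<Longrightarrow> winding_number G z = of_int W"
  obtains a b where "link_interval r \<theta> W l a b"
proof -
  obtain c s \<alpha> where l: "l = Link c s \<alpha>" by (cases l)
  have \<alpha>: "0 < \<alpha>" "\<alpha> \<le> 2 * pi" using assms by (auto simp: l)
  have on: "c + of_real r * cis x \<in> range G" if "x \<in> {s..s + \<alpha>}" for x
  proof -
    have "c + of_real r * cis x \<in> path_image (link_path r l)"
      unfolding l link_path_def using that \<alpha> by (auto simp: path_image_subpath simp flip: subpath_eq_part_circlepath)
    then show ?thesis using assms(4) by blast
  qed
  consider (1) \<psi> where "loop_arc G \<tau> c r s \<alpha> \<psi>"
    | (2) \<psi> where "loop_arc (\<lambda>t. G (- t)) (\<lambda>t. - \<tau> (- t)) c r s \<alpha> \<psi>"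
    by (rule arc_cases[OF assms(1) \<alpha> on])
  then show ?thesis
  proof cases
    case (1 \<psi>)
    interpret loop_arc G \<tau> c r s \<alpha> \<psi> by (rule 1)
    have "link_interval r \<theta> W l (\<psi> s) (\<psi> (s + \<alpha>))"
      unfolding link_interval_def l
      using psi_start_less_end psi_le G_image G_inner_not_end arc_turning[OF \<theta>] convex_link_iff[OF W] W(1) by auto
    then show ?thesis by (rule that)
  next
    case (2 \<psi>)
    interpret rev: loop_arc "\<lambda>t. G (- t)" "\<lambda>t. - \<tau> (- t)" c r s \<alpha> \<psi> by (rule 2)
    \<comment> \<open>The reversed curve winds in the opposite sense, so \<open>- W\<close> decides
      convexity here; its tangent angle is \<open>\<theta> (- t) + pi\<close>, and the parameter
      interval is reflected.\<close>
    have "winding_number (\<lambda>t. G (- t)) z = of_int (- W)" if "z \<in> inside (range G)" for z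
    proof -
      have "z \<notin> range G" using that inside_no_overlap[of "range G"] by blast
      then show ?thesis using winding_number_reverse W(2)[OF that] by simp
    qed
    then have conv: "convex_link r (range G) l \<longleftrightarrow> - W = 1"
      unfolding l using W(1) by (intro rev.convex_link_iff[unfolded range_reverse]) auto
    have "continuous_on UNIV (\<lambda>t. \<theta> (- t) + pi)"
      by (intro continuous_intros continuous_on_compose2[OF \<theta>(1)]) auto
    moreover have "- \<tau> (- t) = cis (\<theta> (- t) + pi)" for t by (simp add: \<theta>(2) flip: cis_mult)
    ultimately have turn: "\<theta> (- \<psi> (s + \<alpha>)) - \<theta> (- \<psi> s) = \<alpha>" using rev.arc_turning by fastforce
    have "G ` {- \<psi> (s + \<alpha>)..- \<psi> s} = (\<lambda>t. G (- t)) ` {\<psi> s..\<psi> (s + \<alpha>)}"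
    proof -
      have "{- \<psi> (s + \<alpha>)..- \<psi> s} = uminus ` {\<psi> s..\<psi> (s + \<alpha>)}" by simp
      then show ?thesis by (simp only: image_image)
    qed
    then have im: "G ` {- \<psi> (s + \<alpha>)..- \<psi> s} = path_image (link_path r l)"
      using rev.G_image by (simp add: l)
    have "G t \<notin> link_ends r l" if "t \<in> {- \<psi> (s + \<alpha>)<..<- \<psi> s}" for t
      using rev.G_inner_not_end[of "- t"] that by (simp add: l)
    then have "link_interval r \<theta> W l (- \<psi> (s + \<alpha>)) (- \<psi> s)"
      unfolding link_interval_def
      using rev.psi_start_less_end rev.psi_le turn conv W(1) im by (auto simp: l)
    then show ?thesis by (rule that)
  qed
qed

lemma link_interval_shift:
  assumes "link_interval r \<theta> W l a b" "\<And>t. \<theta> (t + 1) = \<theta> t + K"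
  shows "link_interval r \<theta> W l (a - of_int m) (b - of_int m)"
proof -
  have \<theta>: "\<theta> (t + of_int m) = \<theta> t + of_int m * K" for t m
  proof (induction m rule: int_induct[where k = 0])
    case (step1 i)
    then show ?case using assms(2)[of "t + of_int i"] by (simp add: algebra_simps)
  next
    case (step2 i)
    then show ?case using assms(2)[of "t + of_int i - 1"] by (simp add: algebra_simps)
  qed simp
  have G: "G (t - of_int m) = G t" for t by (simp add: G_eq_iff)
  have "{a - of_int m..b - of_int m} = (\<lambda>t. t - of_int m) ` {a..b}"
    by (simp add: image_minus_const_atLeastAtMost')
  then have "G ` {a - of_int m..b - of_int m} = G ` {a..b}"
    by (simp only: image_image G)
  moreover have "G t \<notin> link_ends r l" if "t \<in> {a - of_int m<..<b - of_int m}" for t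
  proof -
    have "t + of_int m \<in> {a<..<b}" using that by auto
    then have "G (t + of_int m) \<notin> link_ends r l" using assms(1) unfolding link_interval_def by blast
    then show ?thesis using G[of "t + of_int m"] by simp
  qed
  moreover have "\<theta> (b - of_int m) - \<theta> (a - of_int m) = \<theta> b - \<theta> a"
    using \<theta>[of "b - of_int m" m] \<theta>[of "a - of_int m" m] by simp
  ultimately show ?thesis using assms(1) unfolding link_interval_def by simp
qed

lemma link_intervals_sum:
  assumes r: "r > 0" and L: "finite L" "L \<noteq> {}"
    and cover: "range G = (\<Union>l\<in>L. path_image (link_path r l))"
    and meet: "\<And>l k. l \<in> L \<Longrightarrow> k \<in> L \<Longrightarrow> l \<noteq> k \<Longrightarrow>
      path_image (link_path r l) \<inter> path_image (link_path r k) \<subseteq> link_ends r l \<inter> link_ends r k"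
    and K: "\<And>t. \<theta> (t + 1) = \<theta> t + K"
    and ex: "\<And>l. l \<in> L \<Longrightarrow> \<exists>a b. link_interval r \<theta> W l a b"
  shows "(\<Sum>l\<in>L. (if convex_link r (range G) l then 1 else (- 1 :: real)) * W * link_angle l) = K"
proof -
  obtain a0 b0 where ab0: "\<And>l. l \<in> L \<Longrightarrow> link_interval r \<theta> W l (a0 l) (b0 l)"
    using ex by metis
  obtain l0 where l0: "l0 \<in> L" using L(2) by blast
  \<comment> \<open>The period starts where the interval of some link \<open>l0\<close> starts, so
    that no interval straddles its ends. All intervals are shifted by integers to start within
    it.\<close>
  define A where "A = a0 l0"
  define a where "a l = a0 l - of_int \<lfloor>a0 l - A\<rfloor>" for l
  define b where "b l = b0 l - of_int \<lfloor>a0 l - A\<rfloor>" for l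
  have ab: "link_interval r \<theta> W l (a l) (b l)" if "l \<in> L" for l
    unfolding a_def b_def by (rule link_interval_shift[OF ab0[OF that] K])
  have a: "A \<le> a l" "a l < A + 1" for l unfolding a_def by linarith+
  have a_l0: "a l0 = A" by (simp add: a_def A_def)
  have lt: "a l < b l" "b l \<le> a l + 1" 
    and im: "G ` {a l..b l} = path_image (link_path r l)"
    and inner: "\<And>t. t \<in> {a l<..<b l} \<Longrightarrow> G t \<notin> link_ends r l" if "l \<in> L" for l
    using ab[OF that] unfolding link_interval_def by auto
  have apart: "l = k" if lk: "l \<in> L" "k \<in> L" "t \<in> {a l<..<b l}" "u \<in> {a k<..<b k}" "G t = G u" for l k t u
  proof (rule ccontr)
    assume "l \<noteq> k"
    have "G t \<in> G ` {a l..b l}" "G u \<in> G ` {a k..b k}" using lk(3,4) by (auto intro!: imageI)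
    then have "G t \<in> path_image (link_path r l) \<inter> path_image (link_path r k)"
      unfolding im[OF lk(1)] im[OF lk(2)] lk(5) by blast
    then have "G t \<in> link_ends r l" using meet[OF lk(1,2) \<open>l \<noteq> k\<close>] by blast
    then show False using inner[OF lk(1,3)] by blast
  qed
  have b: "b l \<le> A + 1" if l: "l \<in> L" for l
  proof (rule ccontr)
    assume gt: "\<not> ?thesis"
    \<comment> \<open>A point between \<open>A + 1\<close> and both \<open>b l\<close> and
      \<open>b l0 + 1\<close>: it lies in the interval of \<open>l\<close> and, one period earlier,
      in that of \<open>l0\<close>, which forces \<open>l = l0\<close>.\<close>
    define t where "t = (A + 1 + min (b l) (b l0 + 1)) / 2"
    have "t \<in> {a l<..<b l}" "t - 1 \<in> {a l0<..<b l0}"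
      using gt a[of l] lt(1)[OF l0] a_l0 unfolding t_def by (auto simp: min_def field_simps)
    moreover have "G t = G (t - 1)" by (simp add: G_eq_iff)
    ultimately have "l = l0" by (rule apart[OF l l0])
    then show False using gt lt(2)[OF l0] a_l0 by simp
  qed
  \<comment> \<open>\<open>A\<close> and \<open>A + 1\<close> give the same point of the curve, so
    parameters are unique only in the open period. Its closure is covered too since the finite union
    is closed.\<close>
  have "{A<..<A + 1} \<subseteq> (\<Union>l\<in>L. {a l..b l})"
  proof
    fix t assume t: "t \<in> {A<..<A + 1}"
    obtain l where l: "l \<in> L" "G t \<in> G ` {a l..b l}" using cover im by blast
    then obtain u where u: "u \<in> {a l..b l}" "G t = G u" by auto
    then have "A \<le> u" "u \<le> A + 1" using a[of l] b[OF l(1)] by auto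
    then have "t = u" using t u(2) G_ne[of t u] G_ne[of u t] by fastforce
    then show "t \<in> (\<Union>l\<in>L. {a l..b l})" using u l by blast
  qed
  moreover have "closed (\<Union>l\<in>L. {a l..b l})" using L(1) by auto
  ultimately have "closure {A<..<A + 1} \<subseteq> (\<Union>l\<in>L. {a l..b l})" by (rule closure_minimal)
  then have "{A..A + 1} \<subseteq> (\<Union>l\<in>L. {a l..b l})" by simp
  then have "(\<Sum>l\<in>L. \<theta> (b l) - \<theta> (a l)) = \<theta> (A + 1) - \<theta> A"
  proof (intro sum_tiling[where f = \<theta> and a = a and b = b])
    show "{a l<..<b l} \<inter> {a k<..<b k} = {}" if "l \<in> L" "k \<in> L" "l \<noteq> k" for l k
      using apart[OF that(1,2)] that(3) by blast
  qed (use L(1) lt a b in auto)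
  moreover have "\<theta> (b l) - \<theta> (a l) = (if convex_link r (range G) l then 1 else (- 1 :: real)) * W * link_angle l"
    if "l \<in> L" for l
    using ab[OF that] unfolding link_interval_def by blast
  ultimately show ?thesis using K[of A] by simp
qed

lemma turning_period:
  assumes "continuous_on UNIV \<theta>" "\<And>t. \<tau> t = cis (\<theta> t)"
  shows "\<theta> (t + 1) = \<theta> t + (\<theta> 1 - \<theta> 0)"
proof -
  obtain \<Theta> M where "continuous_on strip \<Theta>" "\<And>p. p \<in> strip \<Longrightarrow> secant p = cis (\<Theta> p)"
    "\<And>s t. (s, t) \<in> strip \<Longrightarrow> \<Theta> (t, s + 1) = \<Theta> (s, t) + M" using secant_lift by metis
  note total_turning[OF this assms]
  from this[of t] this[of 0] show ?thesis by simp
qed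

text \<open>\<open>arc\<close> is an arc traversed in the direction of \<open>G\<close>, from which
  the total turning \<open>2 * pi * W\<close> is read off. The factor \<open>W\<close> then appears
  on both sides and cancels.\<close>

lemma sum_turning:
  assumes r: "r > 0" and L: "finite L"
    and cover: "range G = (\<Union>l\<in>L. path_image (link_path r l))"
    and angle: "\<And>l. l \<in> L \<Longrightarrow> 0 < link_angle l \<and> link_angle l \<le> 2 * pi"
    and meet: "\<And>l k. l \<in> L \<Longrightarrow> k \<in> L \<Longrightarrow> l \<noteq> k \<Longrightarrow>
      path_image (link_path r l) \<inter> path_image (link_path r k) \<subseteq> link_ends r l \<inter> link_ends r k"
    and arc: "loop_arc G \<tau> c r s \<alpha> \<psi>"
  shows "(\<Sum>l\<in>L. (if convex_link r (range G) l then 1 else - 1) * link_angle l) = 2 * pi"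
proof -
  obtain W :: int where W: "W \<in> {1, -1}" "\<And>z. z \<in> inside (range G) \<Longrightarrow> winding_number G z = of_int W"
  proof (rule simple_closed_path_winding_number_inside[OF simple_path_G(1)], unfold path_image_G)
    assume "\<And>z. z \<in> inside (range G) \<Longrightarrow> winding_number G z = 1"
    then show ?thesis using that[of 1] by simp
  next
    assume "\<And>z. z \<in> inside (range G) \<Longrightarrow> winding_number G z = - 1"
    then show ?thesis using that[of "- 1"] by simp
  qed
  obtain \<theta> where \<theta>: "continuous_on UNIV \<theta>" "\<And>t. \<tau> t = cis (\<theta> t)" using tangent_lift by metis
  have "L \<noteq> {}" using cover by auto
  have "\<exists>a b. link_interval r \<theta> W l a b" if "l \<in> L" for l
    using link_interval_exists[OF r _ _ _ \<theta> W, of l] angle[OF that] that cover by blast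
  from link_intervals_sum[OF r L \<open>L \<noteq> {}\<close> cover meet turning_period[OF \<theta>] this]
  have "(\<Sum>l\<in>L. (if convex_link r (range G) l then 1 else (- 1 :: real)) * W * link_angle l) = 2 * pi * W"
    using loop_arc.total_turning_eq[OF arc \<theta> W] by simp
  then have "W * (\<Sum>l\<in>L. (if convex_link r (range G) l then 1 else - 1) * link_angle l) = W * (2 * pi)"
    by (simp add: sum_distrib_left mult_ac)
  then show ?thesis using W(1) by auto
qed

end

theorem theorem2p2:
  fixes n :: nat and r :: real and T :: "complex set" and L :: "link set"
  assumes "n \<ge> 1" and "r > 0"
    and "tangle r T L"
    and "\<forall>l\<in>L. link_angle l = 2 * pi / real n"
  shows "card {l \<in> L. convex_link r T l} = card {l \<in> L. concave_link r T l} + n"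
proof -
  note tangle = assms(3)[unfolded tangle_def]
  have L: "smooth_simple_closed_curve T" "finite L" "T = (\<Union>l\<in>L. path_image (link_path r l))"
    using tangle by - (elim conjE, assumption)+
  have angle: "0 < link_angle l \<and> link_angle l \<le> 2 * pi" if "l \<in> L" for l
    using tangle that by - (elim conjE, drule (1) bspec, blast)
  have meet: "path_image (link_path r l) \<inter> path_image (link_path r k) \<subseteq> link_ends r l \<inter> link_ends r k"
    if "l \<in> L" "k \<in> L" "l \<noteq> k" for l k
  proof -
    have "\<forall>l\<in>L. \<forall>k\<in>L. l \<noteq> k \<longrightarrow>
        path_image (link_path r l) \<inter> path_image (link_path r k) \<subseteq> link_ends r l \<inter> link_ends r k"
      using tangle by - (elim conjE)
    then show ?thesis using that by metis
  qed
  obtain G \<tau> where G: "tangent_loop G \<tau>" "range G = T"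
    using tangent_loop_of_smooth_curve[OF L(1)] by blast
  interpret tangent_loop G \<tau> by (rule G(1))
  interpret rev: tangent_loop "\<lambda>t. G (- t)" "\<lambda>t. - \<tau> (- t)" by (rule reverse)
  have "L \<noteq> {}" using L(3) G(2) by auto
  then obtain l where l: "l \<in> L" by blast
  obtain c s \<alpha> where csa: "l = Link c s \<alpha>" by (cases l)
  have \<alpha>: "0 < \<alpha>" "\<alpha> \<le> 2 * pi" using angle[OF l] by (auto simp: csa)
  have "c + of_real r * cis x \<in> range G" if "x \<in> {s..s + \<alpha>}" for x
  proof -
    have "c + of_real r * cis x \<in> path_image (link_path r l)"
      unfolding csa link_path_def using that \<alpha> by (auto simp: path_image_subpath simp flip: subpath_eq_part_circlepath)
    then show ?thesis using l L(3) G(2) by blast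
  qed
  then consider (1) \<psi> where "loop_arc G \<tau> c r s \<alpha> \<psi>"
    | (2) \<psi> where "loop_arc (\<lambda>t. G (- t)) (\<lambda>t. - \<tau> (- t)) c r s \<alpha> \<psi>"
    by (rule arc_cases[OF assms(2) \<alpha>])
  \<comment> \<open>One link settles the direction: \<open>G\<close> or its reversal traverses it
    counterclockwise, and both have the image \<open>T\<close>, hence the same convex links.\<close>
  then have "(\<Sum>l\<in>L. (if convex_link r T l then 1 else - 1) * link_angle l) = 2 * pi"
  proof cases
    case 1
    from sum_turning[OF assms(2) L(2) _ angle meet this] show ?thesis using G(2) L(3) by simp
  next
    case 2
    from rev.sum_turning[OF assms(2) L(2) _ angle meet this] show ?thesis
      using G(2) L(3) by (simp add: range_reverse)
  qed
  moreover have "(\<Sum>l\<in>L. (if convex_link r T l then 1 else - 1) * link_angle l) =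
      (\<Sum>l\<in>L. (if convex_link r T l then 1 else - 1) * (2 * pi / real n))"
    using assms(4) by (intro sum.cong) auto
  ultimately have "(\<Sum>l\<in>L. (if convex_link r T l then 1 else - 1)) * (2 * pi / real n) = 2 * pi"
    by (simp only: sum_distrib_right)
  then have "(\<Sum>l\<in>L. (if convex_link r T l then 1 else - 1)) = real n"
    using assms(1) by (simp add: field_simps)
  also have "(\<Sum>l\<in>L. (if convex_link r T l then 1 else - 1)) =
      real (card {l \<in> L. convex_link r T l}) - real (card {l \<in> L. concave_link r T l})"
    using L(2) by (simp add: sum.If_cases concave_link_def Int_def)
  finally show ?thesis by linarith
qed

end
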